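(* Let $p$ be an odd prime, let $a\in\mathbb{Z}_p$, and let $\int_{\mathbb{Z}_p}f(x)\,d\mu_{-1}(x)=\lim_{q\to-1}\int_{\mathbb{Z}_p}f(x)\,d\mu_q(x)$. Then $$\tan\frac a2=-\int_{\mathbb{Z}_p}\sin(ax)\,d\mu_{-1}(x)=\sum_{n=0}^\infty\frac{(-1)^{n+1}a^{2n+1}}{(2n+1)!}E_{2n+1},$$ where $E_n$ are the $n$-th Euler numbers.
   Context: Here $\sin$ and $\cos$ are the $p$-adic functions given by their usual power series and $\tan=\sin/\cos$. For a strictly differentiable function $f$ on $\mathbb{Z}_p$ (i.e. $f\in C^{(1)}(\mathbb{Z}_p)$), the $p$-adic $q$-integral is $$\int_{\mathbb{Z}_p}f(x)\,d\mu_q(x)=\lim_{N\to\infty}\frac{1}{[p^N]_q}\sum_{0\le x<p^N}f(x)q^x,\qquad [x]_q=\frac{1-q^x}{1-q},$$ and its value at $q=-1$ (the fermionic $p$-adic integral) is $$\int_{\mathbb{Z}_p}f(x)\,d\mu_{-1}(x)=\lim_{N\to\infty}\sum_{x=0}^{p^N-1}f(x)(-1)^x.$$ The Euler numbers $E_n$ are defined by $\frac{2}{e^t+1}=\sum_{n=0}^\infty E_n\frac{t^n}{n!}$.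
   Formalization: The p-adic sine series is additionally assumed to converge at a (for a in Z_p, p odd, this means a in pZ_p); for a unit a, such as a = 1, the series for sin(ax) diverges already at x = 1, so the integral in the statement is undefined. *)

theory Defs
  imports Complex_Main "HOL-Computational_Algebra.Computational_Algebra"
    "Berlekamp_Zassenhaus.Finite_Field"
begin

(* The p-adic absolute value on the rationals, |r| = p^(v(denominator) - v(numerator)). *)

definition padic_abs :: "nat \<Rightarrow> rat \<Rightarrow> real" where
  "padic_abs p r = (if r = 0 then 0 else
     (case quotient_of r of (a, b) \<Rightarrow>
        real p powi (int (multiplicity (int p) b) - int (multiplicity (int p) a))))"

lemma padic_abs_of_int_div:
  assumes p: "prime p" and "a \<noteq> 0" "b \<noteq> 0"
  shows "padic_abs p (of_int a / of_int b) =
    real p powi (int (multiplicity (int p) b) - int (multiplicity (int p) a))"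
proof -
  obtain c d where q: "quotient_of (of_int a / of_int b) = (c, d)" by (cases "quotient_of (of_int a / of_int b)")
  have d: "d > 0" using q by (rule quotient_of_denom_pos)
  have eq: "(of_int a / of_int b :: rat) = of_int c / of_int d" using q by (rule quotient_of_div)
  have "of_int (a * d) = (of_int (c * b) :: rat)" using eq d assms by (simp add: field_simps)
  then have adcb: "a * d = c * b" by (simp only: of_int_eq_iff)
  then have c: "c \<noteq> 0" using assms d by auto
  have pp: "prime_elem (int p)" using p by simp
  have "multiplicity (int p) a + multiplicity (int p) d = multiplicity (int p) c + multiplicity (int p) b"
    using prime_elem_multiplicity_mult_distrib[OF pp, of a d] prime_elem_multiplicity_mult_distrib[OF pp, of c b]
      adcb assms c d by simp
  then have "int (multiplicity (int p) b) - int (multiplicity (int p) a) = int (multiplicity (int p) d) - int (multiplicity (int p) c)"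
    by linarith
  then show ?thesis using assms by (simp add: padic_abs_def q)
qed

lemma rat_common_denom:
  fixes x y :: rat
  obtains a b c :: int where "c \<noteq> 0" "x = of_int a / of_int c" "y = of_int b / of_int c"
proof -
  obtain a c where x: "c > 0" "x = of_int a / of_int c" 
    by (metis quotient_of_denom_pos quotient_of_div surj_pair)
  obtain b d where y: "d > 0" "y = of_int b / of_int d" 
    by (metis quotient_of_denom_pos quotient_of_div surj_pair)
  show thesis by (rule that[of "c * d" "a * d" "b * c"]) (use x y in auto)
qed

lemma padic_abs_0 [simp]: "padic_abs p 0 = 0"
  by (simp add: padic_abs_def)

lemma padic_abs_nonneg [simp]: "padic_abs p x \<ge> 0"
  by (auto simp: padic_abs_def split: prod.splits)

lemma padic_abs_eq_0_iff [simp]: "prime p \<Longrightarrow> padic_abs p x = 0 \<longleftrightarrow> x = 0"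
  by (auto simp: padic_abs_def prime_gt_0_nat split: prod.splits)

lemma padic_abs_1 [simp]: "prime p \<Longrightarrow> padic_abs p 1 = 1"
  using padic_abs_of_int_div[of p 1 1] by simp

lemma padic_abs_mult:
  assumes p: "prime p"
  shows "padic_abs p (x * y) = padic_abs p x * padic_abs p y"
proof (cases "x = 0 \<or> y = 0")
  case False
  obtain a b c where c: "c \<noteq> 0" and xy: "x = of_int a / of_int c" "y = of_int b / of_int c"
    by (rule rat_common_denom)
  have ab: "a \<noteq> 0" "b \<noteq> 0" using False xy by auto
  have "x * y = of_int (a * b) / of_int (c * c)" using xy by simp
  moreover have pp: "prime_elem (int p)" using p by simp
  moreover have "real p \<noteq> 0" using p by (auto simp: prime_gt_0_nat)
  ultimately show ?thesis
    unfolding xy using padic_abs_of_int_div[OF p] ab c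
    by (simp add: prime_elem_multiplicity_mult_distrib del: of_int_mult flip: power_int_add)
      (simp add: algebra_simps)
qed auto

lemma padic_abs_minus: 
  assumes p: "prime p"
  shows "padic_abs p (- x) = padic_abs p x"
proof -
  have "padic_abs p (-1) = 1" using padic_abs_of_int_div[OF p, of "-1" 1] by simp
  then show ?thesis using padic_abs_mult[OF p, of "-1" x] by simp
qed

lemma padic_abs_minus_commute: "prime p \<Longrightarrow> padic_abs p (x - y) = padic_abs p (y - x)"
  using padic_abs_minus[of p "x - y"] by simp

lemma padic_abs_ultrametric:
  assumes p: "prime p"
  shows "padic_abs p (x + y) \<le> max (padic_abs p x) (padic_abs p y)"
proof (cases "x = 0 \<or> y = 0 \<or> x + y = 0")
  case True
  then show ?thesis using p by (auto simp: le_max_iff_disj)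
next
  case False
  obtain a b c where c: "c \<noteq> 0" and xy: "x = of_int a / of_int c" "y = of_int b / of_int c"
    by (rule rat_common_denom)
  have s: "x + y = of_int (a + b) / of_int c" using xy by (simp add: add_divide_distrib)
  have nz: "a \<noteq> 0" "b \<noteq> 0" "a + b \<noteq> 0" using False xy s by auto
  let ?m = "multiplicity (int p)"
  have "int p ^ min (?m a) (?m b) dvd a + b"
    by (intro dvd_add) (auto intro: multiplicity_dvd')
  then have "min (?m a) (?m b) \<le> ?m (a + b)"
    using p nz by (intro multiplicity_geI) (auto simp: prime_nat_iff)
  then consider "?m a \<le> ?m (a + b)" | "?m b \<le> ?m (a + b)" by linarith
  then show ?thesis
    unfolding s unfolding xy using nz c p prime_gt_1_nat[OF p]
    by cases (auto simp: padic_abs_of_int_div le_max_iff_disj intro!: power_int_increasing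
        simp del: of_int_add)
qed

lemma padic_abs_triangle:
  assumes p: "prime p"
  shows "padic_abs p (x + y) \<le> padic_abs p x + padic_abs p y"
  using padic_abs_ultrametric[OF p, of x y] padic_abs_nonneg[of p x] padic_abs_nonneg[of p y] by linarith

lemma padic_abs_diff_le:
  assumes p: "prime p"
  shows "\<bar>padic_abs p x - padic_abs p y\<bar> \<le> padic_abs p (x - y)"
  using padic_abs_triangle[OF p, of "x - y" y] padic_abs_triangle[OF p, of "y - x" x]
    padic_abs_minus_commute[OF p, of x y] by simp

definition padic_Cauchy :: "nat \<Rightarrow> (nat \<Rightarrow> rat) \<Rightarrow> bool" where
  "padic_Cauchy p X \<longleftrightarrow> (\<forall>e>0. \<exists>M. \<forall>m\<ge>M. \<forall>n\<ge>M. padic_abs p (X m - X n) < e)"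

lemma padic_Cauchy_const: "padic_Cauchy p (\<lambda>_. c)"
  by (auto simp: padic_Cauchy_def)

lemma padic_Cauchy_minus: "prime p \<Longrightarrow> padic_Cauchy p X \<Longrightarrow> padic_Cauchy p (\<lambda>n. - X n)"
  using padic_abs_minus_commute[of p] by (simp add: padic_Cauchy_def)

lemma padic_Cauchy_add:
  assumes p: "prime p" and X: "padic_Cauchy p X" and Y: "padic_Cauchy p Y"
  shows "padic_Cauchy p (\<lambda>n. X n + Y n)"
  unfolding padic_Cauchy_def
proof (intro allI impI)
  fix e :: real assume e: "e > 0"
  obtain M where M: "\<forall>m\<ge>M. \<forall>n\<ge>M. padic_abs p (X m - X n) < e" using X e by (auto simp: padic_Cauchy_def)
  obtain N where N: "\<forall>m\<ge>N. \<forall>n\<ge>N. padic_abs p (Y m - Y n) < e" using Y e by (auto simp: padic_Cauchy_def)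
  show "\<exists>M. \<forall>m\<ge>M. \<forall>n\<ge>M. padic_abs p (X m + Y m - (X n + Y n)) < e"
  proof (intro exI allI impI)
    fix m n assume "max M N \<le> m" "max M N \<le> n"
    then have "padic_abs p (X m - X n) < e" "padic_abs p (Y m - Y n) < e" using M N by auto
    moreover have "X m + Y m - (X n + Y n) = (X m - X n) + (Y m - Y n)" by simp
    ultimately show "padic_abs p (X m + Y m - (X n + Y n)) < e"
      using padic_abs_ultrametric[OF p, of "X m - X n" "Y m - Y n"] by (simp only: less_max_iff_disj max_less_iff_conj le_less_trans)
  qed
qed

lemma padic_Cauchy_abs:
  assumes p: "prime p" and X: "padic_Cauchy p X"
  shows "Cauchy (\<lambda>n. padic_abs p (X n))"
  unfolding Cauchy_def dist_real_def
  using X padic_abs_diff_le[OF p] unfolding padic_Cauchy_def by (meson order.strict_trans1)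

lemma padic_Cauchy_bounded:
  assumes p: "prime p" and X: "padic_Cauchy p X"
  obtains B where "B > 0" "\<And>n. padic_abs p (X n) \<le> B"
proof -
  have "Bseq (\<lambda>n. padic_abs p (X n))"
    using Cauchy_Bseq[OF padic_Cauchy_abs[OF p X]] .
  then show thesis using that by (auto simp: Bseq_def)
qed

lemma padic_Cauchy_mult:
  assumes p: "prime p" and X: "padic_Cauchy p X" and Y: "padic_Cauchy p Y"
  shows "padic_Cauchy p (\<lambda>n. X n * Y n)"
  unfolding padic_Cauchy_def
proof (intro allI impI)
  fix e :: real assume e: "e > 0"
  obtain A where A: "A > 0" "\<And>n. padic_abs p (X n) \<le> A" using padic_Cauchy_bounded[OF p X] by blast
  obtain B where B: "B > 0" "\<And>n. padic_abs p (Y n) \<le> B" using padic_Cauchy_bounded[OF p Y] by blast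
  obtain M where M: "\<forall>m\<ge>M. \<forall>n\<ge>M. padic_abs p (X m - X n) < e / B"
    using X e B by (metis padic_Cauchy_def divide_pos_pos)
  obtain N where N: "\<forall>m\<ge>N. \<forall>n\<ge>N. padic_abs p (Y m - Y n) < e / A"
    using Y e A by (metis padic_Cauchy_def divide_pos_pos)
  show "\<exists>M. \<forall>m\<ge>M. \<forall>n\<ge>M. padic_abs p (X m * Y m - X n * Y n) < e"
  proof (intro exI allI impI)
    fix m n assume mn: "max M N \<le> m" "max M N \<le> n"
    have "padic_abs p (X m) * padic_abs p (Y m - Y n) \<le> A * padic_abs p (Y m - Y n)"
      using A by (intro mult_right_mono) auto
    also have "\<dots> < e" using N mn A by (simp add: field_simps)
    finally have 1: "padic_abs p (X m * (Y m - Y n)) < e" by (simp add: padic_abs_mult[OF p])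
    have "padic_abs p (X m - X n) * padic_abs p (Y n) \<le> padic_abs p (X m - X n) * B"
      using B by (intro mult_left_mono) auto
    also have "\<dots> < e" using M mn B by (simp add: field_simps)
    finally have 2: "padic_abs p ((X m - X n) * Y n) < e" by (simp add: padic_abs_mult[OF p])
    have "X m * Y m - X n * Y n = X m * (Y m - Y n) + (X m - X n) * Y n" by (simp add: algebra_simps)
    then show "padic_abs p (X m * Y m - X n * Y n) < e"
      using padic_abs_ultrametric[OF p, of "X m * (Y m - Y n)" "(X m - X n) * Y n"] 1 2 by auto
  qed
qed

lemma padic_abs_inverse: "prime p \<Longrightarrow> padic_abs p (inverse x) = inverse (padic_abs p x)"
  using padic_abs_mult[of p x "inverse x"]
  by (cases "x = 0") (auto simp: field_simps)

lemma padic_Cauchy_inverse: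
  assumes p: "prime p" and X: "padic_Cauchy p X" and nz: "\<not> (\<lambda>n. padic_abs p (X n)) \<longlonglongrightarrow> 0"
  shows "padic_Cauchy p (\<lambda>n. inverse (X n))"
  unfolding padic_Cauchy_def
proof (intro allI impI)
  fix e :: real assume e: "e > 0"
  obtain L where L: "(\<lambda>n. padic_abs p (X n)) \<longlonglongrightarrow> L"
    using padic_Cauchy_abs[OF p X] by (auto simp: Cauchy_convergent_iff convergent_def)
  have "L \<ge> 0" using L by (rule LIMSEQ_le_const) auto
  then have L0: "L > 0" using nz L by (metis less_eq_real_def)
  then have "\<forall>\<^sub>F n in sequentially. padic_abs p (X n) > L / 2"
    using order_tendstoD(1)[OF L, of "L / 2"] by simp
  then obtain N where N: "\<And>n. n \<ge> N \<Longrightarrow> padic_abs p (X n) > L / 2"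
    by (auto simp: eventually_sequentially)
  obtain M where M: "\<forall>m\<ge>M. \<forall>n\<ge>M. padic_abs p (X m - X n) < e * (L / 2)\<^sup>2"
    using X e L0 unfolding padic_Cauchy_def by (meson half_gt_zero mult_pos_pos zero_less_power)
  show "\<exists>M. \<forall>m\<ge>M. \<forall>n\<ge>M. padic_abs p (inverse (X m) - inverse (X n)) < e"
  proof (intro exI allI impI)
    fix m n assume mn: "max M N \<le> m" "max M N \<le> n"
    let ?a = "padic_abs p (X m)" and ?b = "padic_abs p (X n)"
    have ab: "?a > L / 2" "?b > L / 2" using N mn by auto
    then have nz: "X m \<noteq> 0" "X n \<noteq> 0" using L0 by auto
    have "inverse (X m) - inverse (X n) = (X n - X m) * (inverse (X m) * inverse (X n))"
      using nz by (simp add: field_simps)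
    then have eq: "padic_abs p (inverse (X m) - inverse (X n)) = padic_abs p (X n - X m) / (?a * ?b)"
      by (simp only: padic_abs_mult[OF p] padic_abs_inverse[OF p] divide_inverse inverse_mult_distrib)
    have "(L / 2)\<^sup>2 \<le> ?a * ?b" 
      unfolding power2_eq_square using ab L0 by (intro mult_mono) auto
    then have "e * (L / 2)\<^sup>2 \<le> e * (?a * ?b)" using e by simp
    moreover have "padic_abs p (X n - X m) < e * (L / 2)\<^sup>2" using M mn by auto
    moreover have "?a * ?b > 0" using ab L0 by simp
    ultimately show "padic_abs p (inverse (X m) - inverse (X n)) < e"
      unfolding eq by (simp add: divide_less_eq)
  qed
qed

(* The field of p-adic numbers is built as the completion of the rationals: Cauchy sequences
   for the p-adic absolute value modulo null sequences. The prime is CARD('p). *)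

typedef ('p::prime_card) padic_seq = "{X. padic_Cauchy CARD('p) X}"
  morphisms padic_seq_nth Abs_padic_seq
  using padic_Cauchy_const by blast

setup_lifting type_definition_padic_seq

instantiation padic_seq :: (prime_card) comm_ring_1
begin

lift_definition zero_padic_seq :: "'a padic_seq" is "\<lambda>_. 0" by (rule padic_Cauchy_const)
lift_definition one_padic_seq :: "'a padic_seq" is "\<lambda>_. 1" by (rule padic_Cauchy_const)
lift_definition uminus_padic_seq :: "'a padic_seq \<Rightarrow> 'a padic_seq" is "\<lambda>X n. - X n"
  by (rule padic_Cauchy_minus[OF prime_card])
lift_definition plus_padic_seq :: "'a padic_seq \<Rightarrow> 'a padic_seq \<Rightarrow> 'a padic_seq" is "\<lambda>X Y n. X n + Y n"
  by (rule padic_Cauchy_add[OF prime_card])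
lift_definition minus_padic_seq :: "'a padic_seq \<Rightarrow> 'a padic_seq \<Rightarrow> 'a padic_seq" is "\<lambda>X Y n. X n - Y n"
  using padic_Cauchy_add[OF prime_card _ padic_Cauchy_minus[OF prime_card]] by fastforce
lift_definition times_padic_seq :: "'a padic_seq \<Rightarrow> 'a padic_seq \<Rightarrow> 'a padic_seq" is "\<lambda>X Y n. X n * Y n"
  by (rule padic_Cauchy_mult[OF prime_card])

instance
  by standard (transfer; simp add: algebra_simps fun_eq_iff)+

end

lift_definition padic_seq_const :: "rat \<Rightarrow> 'p::prime_card padic_seq" is "\<lambda>c _. c"
  by (rule padic_Cauchy_const)

lift_definition padic_seq_inverse :: "'p::prime_card padic_seq \<Rightarrow> 'p padic_seq" is
  "\<lambda>X. if (\<lambda>n. padic_abs CARD('p) (X n)) \<longlonglongrightarrow> 0 then (\<lambda>_. 0) else (\<lambda>n. inverse (X n))"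
  using padic_Cauchy_inverse[OF prime_card] padic_Cauchy_const by auto

definition padic_seq_norm :: "'p::prime_card padic_seq \<Rightarrow> real" where
  "padic_seq_norm X = lim (\<lambda>n. padic_abs CARD('p) (padic_seq_nth X n))"

lemma padic_seq_norm_LIMSEQ:
  "(\<lambda>n. padic_abs CARD('p) (padic_seq_nth X n)) \<longlonglongrightarrow> padic_seq_norm (X :: 'p::prime_card padic_seq)"
  using padic_Cauchy_abs[OF prime_card] padic_seq_nth[of X]
  by (auto simp: padic_seq_norm_def Cauchy_convergent_iff convergent_LIMSEQ_iff)

lemma padic_seq_norm_eqI:
  "(\<lambda>n. padic_abs CARD('p) (padic_seq_nth X n)) \<longlonglongrightarrow> l \<Longrightarrow> padic_seq_norm (X :: 'p::prime_card padic_seq) = l"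
  using padic_seq_norm_LIMSEQ[of X] by (rule LIMSEQ_unique)

lemma padic_seq_norm_nonneg: "padic_seq_norm X \<ge> 0"
  by (rule LIMSEQ_le_const[OF padic_seq_norm_LIMSEQ]) auto

lemma padic_seq_norm_const: "padic_seq_norm (padic_seq_const c :: 'p::prime_card padic_seq) = padic_abs CARD('p) c"
  by (rule padic_seq_norm_eqI) (simp add: padic_seq_const.rep_eq)

lemma padic_seq_norm_minus: "padic_seq_norm (- X) = padic_seq_norm X"
  by (rule padic_seq_norm_eqI)
    (use padic_seq_norm_LIMSEQ[of X] in \<open>simp add: uminus_padic_seq.rep_eq padic_abs_minus[OF prime_card]\<close>)

lemma padic_seq_norm_minus_commute: "padic_seq_norm (X - Y) = padic_seq_norm (Y - X)"
  using padic_seq_norm_minus[of "X - Y"] by simp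

lemma padic_seq_norm_mult: "padic_seq_norm (X * Y) = padic_seq_norm X * padic_seq_norm Y"
  by (rule padic_seq_norm_eqI)
    (use tendsto_mult[OF padic_seq_norm_LIMSEQ[of X] padic_seq_norm_LIMSEQ[of Y]]
     in \<open>simp add: times_padic_seq.rep_eq padic_abs_mult[OF prime_card]\<close>)

lemma padic_seq_norm_add: "padic_seq_norm (X + Y) \<le> max (padic_seq_norm X) (padic_seq_norm Y)"
  by (rule LIMSEQ_le[OF padic_seq_norm_LIMSEQ tendsto_max[OF padic_seq_norm_LIMSEQ padic_seq_norm_LIMSEQ]])
    (auto simp: plus_padic_seq.rep_eq padic_abs_ultrametric[OF prime_card])

lemma padic_seq_norm_0: "padic_seq_norm 0 = 0"
  by (rule padic_seq_norm_eqI) (simp add: zero_padic_seq.rep_eq)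

lemma padic_seq_norm_add_0: "padic_seq_norm X = 0 \<Longrightarrow> padic_seq_norm Y = 0 \<Longrightarrow> padic_seq_norm (X + Y) = 0"
  using padic_seq_norm_add[of X Y] padic_seq_norm_nonneg[of "X + Y"] by simp

lemma padic_seq_inverse_eq:
  "padic_seq_norm X \<noteq> 0 \<Longrightarrow> padic_seq_nth (padic_seq_inverse X) n = inverse (padic_seq_nth X n)"
  using padic_seq_norm_eqI[of X 0] by (auto simp: padic_seq_inverse.rep_eq)

lemma padic_seq_inverse_0: "padic_seq_norm X = 0 \<Longrightarrow> padic_seq_inverse X = 0"
  using padic_seq_norm_LIMSEQ[of X] by (auto simp: padic_seq_inverse_def zero_padic_seq_def)

lemma padic_seq_inverse_mult:
  assumes "padic_seq_norm X \<noteq> 0"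
  shows "padic_seq_norm (X * padic_seq_inverse X - 1) = 0"
proof (rule padic_seq_norm_eqI)
  have "\<forall>\<^sub>F n in sequentially. padic_abs CARD('a) (padic_seq_nth X n) \<noteq> 0"
    using tendsto_imp_eventually_ne[OF padic_seq_norm_LIMSEQ assms] .
  then have "\<forall>\<^sub>F n in sequentially. padic_abs CARD('a) (padic_seq_nth (X * padic_seq_inverse X - 1) n) = 0"
    by eventually_elim
      (auto simp: minus_padic_seq.rep_eq times_padic_seq.rep_eq one_padic_seq.rep_eq
        padic_seq_inverse_eq[OF assms] prime_card)
  then show "(\<lambda>n. padic_abs CARD('a) (padic_seq_nth (X * padic_seq_inverse X - 1) n)) \<longlonglongrightarrow> 0"
    by (rule tendsto_eventually)
qed

definition padic_rel :: "'p::prime_card padic_seq \<Rightarrow> 'p padic_seq \<Rightarrow> bool" where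
  "padic_rel X Y \<longleftrightarrow> (\<lambda>n. padic_abs CARD('p) (padic_seq_nth X n - padic_seq_nth Y n)) \<longlonglongrightarrow> 0"

lemma padic_rel_iff: "padic_rel X Y \<longleftrightarrow> padic_seq_norm (X - Y) = 0"
proof
  show "padic_rel X Y \<Longrightarrow> padic_seq_norm (X - Y) = 0"
    by (rule padic_seq_norm_eqI) (simp add: padic_rel_def minus_padic_seq.rep_eq)
  show "padic_seq_norm (X - Y) = 0 \<Longrightarrow> padic_rel X Y"
    using padic_seq_norm_LIMSEQ[of "X - Y"] by (simp add: padic_rel_def minus_padic_seq.rep_eq)
qed

lemma equivp_padic_rel: "equivp (padic_rel :: 'p::prime_card padic_seq \<Rightarrow> _)"
proof (rule equivpI)
  show "reflp (padic_rel :: 'p padic_seq \<Rightarrow> _)" by (rule reflpI) (simp add: padic_rel_def)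
  show "symp (padic_rel :: 'p padic_seq \<Rightarrow> _)"
  proof (rule sympI)
    fix X Y :: "'p padic_seq" assume "padic_rel X Y"
    then show "padic_rel Y X" using padic_seq_norm_minus[of "X - Y"] by (simp add: padic_rel_iff)
  qed
  show "transp (padic_rel :: 'p padic_seq \<Rightarrow> _)"
  proof (rule transpI)
    fix X Y Z :: "'p padic_seq" assume "padic_rel X Y" "padic_rel Y Z"
    then show "padic_rel X Z"
      using padic_seq_norm_add_0[of "X - Y" "Y - Z"] by (simp add: padic_rel_iff)
  qed
qed

quotient_type 'p padic = "'p::prime_card padic_seq" / padic_rel
  by (rule equivp_padic_rel)

lemma padic_rel_mult:
  assumes "padic_rel X X'" "padic_rel Y Y'"
  shows "padic_rel (X * Y) (X' * Y')"
proof -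
  have "X * Y - X' * Y' = X * (Y - Y') + (X - X') * Y'" by (simp add: algebra_simps)
  then show ?thesis using assms
    by (auto simp: padic_rel_iff padic_seq_norm_mult intro!: padic_seq_norm_add_0)
qed

lemma padic_rel_norm:
  assumes "padic_rel X Y"
  shows "padic_seq_norm X = padic_seq_norm Y"
  using padic_seq_norm_add[of "X - Y" Y] padic_seq_norm_add[of "Y - X" X] assms
    padic_seq_norm_minus[of "X - Y"] padic_seq_norm_nonneg[of X] padic_seq_norm_nonneg[of Y]
  by (simp add: padic_rel_iff)

instantiation padic :: (prime_card) field
begin

lift_definition zero_padic :: "'a padic" is 0 .
lift_definition one_padic :: "'a padic" is 1 .
lift_definition uminus_padic :: "'a padic \<Rightarrow> 'a padic" is uminus
  by (simp add: padic_rel_iff padic_seq_norm_minus_commute)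
lift_definition plus_padic :: "'a padic \<Rightarrow> 'a padic \<Rightarrow> 'a padic" is "(+)"
  by (simp add: padic_rel_iff add_diff_add padic_seq_norm_add_0)
lift_definition minus_padic :: "'a padic \<Rightarrow> 'a padic \<Rightarrow> 'a padic" is "(-)"
proof -
  fix X X' Y Y' :: "'a padic_seq" assume "padic_rel X X'" "padic_rel Y Y'"
  then have "padic_seq_norm ((X - X') + - (Y - Y')) = 0"
    by (intro padic_seq_norm_add_0) (simp_all only: padic_rel_iff padic_seq_norm_minus)
  then show "padic_rel (X - Y) (X' - Y')"
    by (simp add: padic_rel_iff algebra_simps)
qed
lift_definition times_padic :: "'a padic \<Rightarrow> 'a padic \<Rightarrow> 'a padic" is "(*)"
  by (rule padic_rel_mult)
lift_definition inverse_padic :: "'a padic \<Rightarrow> 'a padic" is padic_seq_inverse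
proof -
  fix X Y :: "'a padic_seq" assume XY: "padic_rel X Y"
  show "padic_rel (padic_seq_inverse X) (padic_seq_inverse Y)"
  proof (cases "padic_seq_norm X = 0")
    case True
    then show ?thesis using padic_rel_norm[OF XY] by (simp add: padic_seq_inverse_0 padic_rel_iff padic_seq_norm_0)
  next
    case False
    let ?X = "padic_seq_inverse X" and ?Y = "padic_seq_inverse Y"
    have "padic_rel (X * ?X) 1" "padic_rel (Y * ?Y) 1"
      using False padic_rel_norm[OF XY] by (simp_all add: padic_rel_iff padic_seq_inverse_mult)
    then have "padic_seq_norm ((X * ?X - 1) - (Y * ?Y - 1)) = 0"
      using padic_seq_norm_add_0[of "X * ?X - 1" "- (Y * ?Y - 1)"] by (simp only: padic_rel_iff padic_seq_norm_minus diff_conv_add_uminus)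
    moreover have "padic_seq_norm ((Y - X) * ?Y) = 0"
      using XY padic_seq_norm_minus_commute[of X Y] by (simp add: padic_rel_iff padic_seq_norm_mult)
    moreover have "X * (?X - ?Y) = ((X * ?X - 1) - (Y * ?Y - 1)) + (Y - X) * ?Y"
      by (simp add: algebra_simps)
    ultimately have "padic_seq_norm (X * (?X - ?Y)) = 0" by (simp only: padic_seq_norm_add_0)
    then show ?thesis using False by (simp add: padic_rel_iff padic_seq_norm_mult)
  qed
qed
definition divide_padic :: "'a padic \<Rightarrow> 'a padic \<Rightarrow> 'a padic" where
  "divide_padic x y = x * inverse y"

instance
proof
  have 1: "padic_seq_norm (1 :: 'a padic_seq) = 1"
    by (rule padic_seq_norm_eqI) (simp add: one_padic_seq.rep_eq prime_card)
  show "(0 :: 'a padic) \<noteq> 1"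
    by transfer (simp add: padic_rel_iff padic_seq_norm_minus 1)
  fix x :: "'a padic"
  show "x \<noteq> 0 \<Longrightarrow> inverse x * x = 1"
    by transfer (simp add: padic_rel_iff padic_seq_inverse_mult mult.commute)
  show "inverse (0 :: 'a padic) = 0"
    by transfer (simp add: padic_rel_iff padic_seq_inverse_0 padic_seq_norm_0)
qed (transfer; simp add: algebra_simps padic_rel_iff padic_seq_norm_0; fail | simp add: divide_padic_def)+

end

lift_definition padic_norm :: "'p::prime_card padic \<Rightarrow> real" is padic_seq_norm
  by (rule padic_rel_norm)

lemma padic_norm_nonneg [simp]: "padic_norm (x :: 'p::prime_card padic) \<ge> 0"
  by transfer (rule padic_seq_norm_nonneg)

lemma padic_norm_eq_0_iff [simp]: "padic_norm (x :: 'p::prime_card padic) = 0 \<longleftrightarrow> x = 0"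
  by transfer (simp add: padic_rel_iff)

lemma padic_norm_0 [simp]: "padic_norm 0 = 0"
  by simp

lemma padic_norm_minus [simp]: "padic_norm (- x :: 'p::prime_card padic) = padic_norm x"
  by transfer (rule padic_seq_norm_minus)

lemma padic_norm_mult: "padic_norm (x * y :: 'p::prime_card padic) = padic_norm x * padic_norm y"
  by transfer (rule padic_seq_norm_mult)

lemma padic_norm_add_le_max: "padic_norm (x + y :: 'p::prime_card padic) \<le> max (padic_norm x) (padic_norm y)"
  by transfer (rule padic_seq_norm_add)

lemma padic_diff_diff_cancel: "x - z - (y - z) = (x - y :: 'p::prime_card padic)"
  by (simp add: algebra_simps)

lemma padic_norm_diff_le_max: "padic_norm (x - y :: 'p::prime_card padic) \<le> max (padic_norm x) (padic_norm y)"
  using padic_norm_add_le_max[of x "- y"] by simp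

lemma abs_padic_of_nat: "abs_padic (padic_seq_const (of_nat n) :: 'p::prime_card padic_seq) = of_nat n"
proof (induction n)
  case 0
  have "padic_seq_const 0 = (0 :: 'p padic_seq)" by transfer simp
  then show ?case by (simp add: zero_padic.abs_eq)
next
  case (Suc n)
  have "padic_seq_const (of_nat (Suc n)) = (1 + padic_seq_const (of_nat n) :: 'p padic_seq)" by transfer simp
  then show ?case using Suc by (simp add: one_padic.abs_eq flip: plus_padic.abs_eq)
qed

lemma padic_norm_of_nat: "padic_norm (of_nat n :: 'p::prime_card padic) = padic_abs CARD('p) (of_nat n)"
  by (simp add: padic_norm.abs_eq padic_seq_norm_const flip: abs_padic_of_nat)

instance padic :: (prime_card) field_char_0
proof
  have "n = 0" if "of_nat n = (0 :: 'a padic)" for n :: nat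
    using padic_norm_of_nat[of n, where 'p = 'a] that prime_card[where 'a = 'a] by simp
  note nat_0 = this
  show "inj (of_nat :: nat \<Rightarrow> 'a padic)"
  proof (rule linorder_injI)
    fix m n :: nat assume "m < n"
    then have "(of_nat n :: 'a padic) = of_nat m + of_nat (n - m)"
      by (metis le_add_diff_inverse less_imp_le of_nat_add)
    moreover have "n - m \<noteq> 0" using \<open>m < n\<close> by simp
    ultimately show "(of_nat m :: 'a padic) \<noteq> of_nat n" using nat_0[of "n - m"] by fastforce
  qed
qed

lemma abs_padic_of_rat: "abs_padic (padic_seq_const r :: 'p::prime_card padic_seq) = of_rat r"
proof -
  have minus: "abs_padic (padic_seq_const (- r) :: 'p padic_seq) = - abs_padic (padic_seq_const r)" for r
  proof -
    have "padic_seq_const (- r) = (- padic_seq_const r :: 'p padic_seq)" by transfer simp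
    then show ?thesis by (simp add: uminus_padic.abs_eq)
  qed
  have int: "abs_padic (padic_seq_const (of_int k) :: 'p padic_seq) = of_int k" for k
    by (cases k) (simp_all add: abs_padic_of_nat minus del: of_nat_Suc)
  obtain a b where r: "b > 0" "r = of_int a / of_int b"
    by (metis quotient_of_denom_pos quotient_of_div surj_pair)
  have "padic_seq_const r * padic_seq_const (of_int b) = (padic_seq_const (of_int a) :: 'p padic_seq)"
    using r by transfer simp
  then have "abs_padic (padic_seq_const r) * of_int b = (of_int a :: 'p padic)"
    by (metis int times_padic.abs_eq)
  then have "abs_padic (padic_seq_const r) = of_int a / (of_int b :: 'p padic)"
    using r(1) by (simp add: eq_divide_eq)
  also have "\<dots> = of_rat r" unfolding r(2) by (simp add: of_rat_divide)
  finally show ?thesis .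
qed

lemma padic_norm_of_rat: "padic_norm (of_rat r :: 'p::prime_card padic) = padic_abs CARD('p) r"
  by (simp add: padic_norm.abs_eq padic_seq_norm_const flip: abs_padic_of_rat)

instantiation padic :: (prime_card) metric_space
begin

definition dist_padic :: "'a padic \<Rightarrow> 'a padic \<Rightarrow> real" where
  "dist_padic x y = padic_norm (x - y)"

definition uniformity_padic :: "('a padic \<times> 'a padic) filter" where
  "uniformity_padic = (INF e\<in>{0<..}. principal {(x, y). dist x y < e})"

definition open_padic :: "'a padic set \<Rightarrow> bool" where
  "open_padic U \<longleftrightarrow> (\<forall>x\<in>U. \<forall>\<^sub>F (x', y) in uniformity. x' = x \<longrightarrow> y \<in> U)"

instance
proof
  fix x y z :: "'a padic"
  show "dist x y = 0 \<longleftrightarrow> x = y" by (simp add: dist_padic_def)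
  show "dist x y \<le> dist x z + dist y z"
  proof -
    have "padic_norm ((x - z) - (y - z)) \<le> max (padic_norm (x - z)) (padic_norm (y - z))"
      by (rule padic_norm_diff_le_max)
    also have "\<dots> \<le> padic_norm (x - z) + padic_norm (y - z)"
      by (rule max.boundedI) simp_all
    also have "(x - z) - (y - z) = x - y" by (rule padic_diff_diff_cancel)
    finally show ?thesis unfolding dist_padic_def .
  qed
qed (rule uniformity_padic_def open_padic_def)+

end

lemma abs_padic_limit:
  "(\<lambda>n. of_rat (padic_seq_nth X n)) \<longlonglongrightarrow> (abs_padic X :: 'p::prime_card padic)"
proof (rule metric_LIMSEQ_I)
  fix e :: real assume e: "e > 0"
  obtain M where M: "\<And>m n. m \<ge> M \<Longrightarrow> n \<ge> M \<Longrightarrow> padic_abs CARD('p) (padic_seq_nth X m - padic_seq_nth X n) < e / 2"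
  proof -
    have "padic_Cauchy CARD('p) (padic_seq_nth X)" using padic_seq_nth[of X] by simp
    moreover have "e / 2 > 0" using e by simp
    ultimately show thesis using that unfolding padic_Cauchy_def by blast
  qed
  show "\<exists>M. \<forall>m\<ge>M. dist (of_rat (padic_seq_nth X m)) (abs_padic X) < e"
  proof (intro exI allI impI)
    fix m assume m: "m \<ge> M"
    let ?Y = "padic_seq_const (padic_seq_nth X m) - X"
    have "padic_seq_norm ?Y \<le> e / 2"
      by (rule LIMSEQ_le_const2[OF padic_seq_norm_LIMSEQ])
        (use M[OF m] in \<open>auto simp: minus_padic_seq.rep_eq padic_seq_const.rep_eq intro!: exI[of _ M] less_imp_le\<close>)
    then show "dist (of_rat (padic_seq_nth X m)) (abs_padic X) < e"
      using e by (simp add: dist_padic_def minus_padic.abs_eq padic_norm.abs_eq flip: abs_padic_of_rat)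
  qed
qed

lemma padic_rat_dense:
  assumes "e > 0"
  shows "\<exists>r. dist (x :: 'p::prime_card padic) (of_rat r) < e"
proof -
  obtain X where "x = abs_padic X" by (metis Quotient3_abs_rep Quotient3_padic)
  then obtain N where "\<forall>n\<ge>N. dist (of_rat (padic_seq_nth X n)) x < e"
    using metric_LIMSEQ_D[OF abs_padic_limit[of X] assms] by blast
  then have "dist (of_rat (padic_seq_nth X N)) x < e" by simp
  then show ?thesis by (auto simp: dist_commute[of x])
qed

instance padic :: (prime_card) complete_space
proof
  fix x :: "nat \<Rightarrow> 'a padic" assume x: "Cauchy x"
  have "\<forall>n. \<exists>r. dist (x n) (of_rat r) < inverse (real (Suc n))"
    by (intro allI padic_rat_dense) simp
  then obtain r where r: "\<And>n. dist (x n) (of_rat (r n)) < inverse (real (Suc n))" by metis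
  have conv: "(\<lambda>n. dist (x n) (of_rat (r n))) \<longlonglongrightarrow> 0"
    by (rule tendsto_sandwich[OF _ _ tendsto_const LIMSEQ_inverse_real_of_nat])
      (intro always_eventually allI zero_le_dist less_imp_le r)+
  have "padic_Cauchy CARD('a) r"
    unfolding padic_Cauchy_def
  proof (intro allI impI)
    fix e :: real assume e: "e > 0"
    obtain M where M: "\<And>m n. m \<ge> M \<Longrightarrow> n \<ge> M \<Longrightarrow> dist (x m) (x n) < e / 3"
      using x e by (metis Cauchy_def divide_pos_pos zero_less_numeral)
    obtain N where N: "\<And>n. n \<ge> N \<Longrightarrow> dist (x n) (of_rat (r n)) < e / 3"
      using order_tendstoD(2)[OF conv, of "e / 3"] e by (auto simp: eventually_sequentially)
    show "\<exists>M. \<forall>m\<ge>M. \<forall>n\<ge>M. padic_abs CARD('a) (r m - r n) < e"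
    proof (intro exI allI impI)
      fix m n assume mn: "max M N \<le> m" "max M N \<le> n"
      have "dist (of_rat (r m)) (of_rat (r n) :: 'a padic) \<le>
          dist (x m) (of_rat (r m)) + dist (x m) (x n) + dist (x n) (of_rat (r n))"
        using dist_triangle2[of "of_rat (r m)" "of_rat (r n)" "x n"] dist_triangle2[of "of_rat (r m)" "x n" "x m"]
        by (simp add: dist_commute)
      also have "\<dots> < e / 3 + e / 3 + e / 3" using M[of m n] N[of m] N[of n] mn by auto
      finally show "padic_abs CARD('a) (r m - r n) < e"
        by (simp add: dist_padic_def padic_norm_of_rat flip: of_rat_diff)
    qed
  qed
  then have "padic_seq_nth (Abs_padic_seq r :: 'a padic_seq) = r" by (simp add: Abs_padic_seq_inverse)
  then have "(\<lambda>n. of_rat (r n)) \<longlonglongrightarrow> (abs_padic (Abs_padic_seq r) :: 'a padic)"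
    using abs_padic_limit[of "Abs_padic_seq r :: 'a padic_seq"] by simp
  from tendsto_add[OF conv iffD1[OF tendsto_dist_iff this]]
  have lim: "(\<lambda>n. dist (x n) (of_rat (r n)) + dist (of_rat (r n)) (abs_padic (Abs_padic_seq r) :: 'a padic)) \<longlonglongrightarrow> 0"
    by simp
  have "(\<lambda>n. dist (x n) (abs_padic (Abs_padic_seq r) :: 'a padic)) \<longlonglongrightarrow> 0"
    by (rule tendsto_sandwich[OF _ _ tendsto_const lim])
      (intro always_eventually allI zero_le_dist dist_triangle)+
  then have "x \<longlonglongrightarrow> (abs_padic (Abs_padic_seq r) :: 'a padic)"
    by (rule iffD2[OF tendsto_dist_iff])
  then show "convergent x" by (auto simp: convergent_def)
qed

definition padic_ints :: "'p::prime_card padic set" where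
  "padic_ints = {x. padic_norm x \<le> 1}"

definition padic_sin_term :: "'p::prime_card padic \<Rightarrow> nat \<Rightarrow> 'p padic" where
  "padic_sin_term x n = (-1) ^ n * x ^ (2 * n + 1) / fact (2 * n + 1)"

definition padic_cos_term :: "'p::prime_card padic \<Rightarrow> nat \<Rightarrow> 'p padic" where
  "padic_cos_term x n = (-1) ^ n * x ^ (2 * n) / fact (2 * n)"

(* The domains on which the power series converge; outside them the suminf below is an
   unspecified value. For odd p the sine domain is the disc |x| < p^(-1/(p-1)), i.e. p * Z_p. *)

definition padic_sin_domain :: "'p::prime_card padic set" where
  "padic_sin_domain = {x. summable (padic_sin_term x)}"

definition padic_cos_domain :: "'p::prime_card padic set" where
  "padic_cos_domain = {x. summable (padic_cos_term x)}"

definition padic_sin :: "'p::prime_card padic \<Rightarrow> 'p padic" where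
  "padic_sin x = (\<Sum>n. padic_sin_term x n)"

definition padic_cos :: "'p::prime_card padic \<Rightarrow> 'p padic" where
  "padic_cos x = (\<Sum>n. padic_cos_term x n)"

definition padic_tan_domain :: "'p::prime_card padic set" where
  "padic_tan_domain = {x \<in> padic_sin_domain \<inter> padic_cos_domain. padic_cos x \<noteq> 0}"

definition padic_tan :: "'p::prime_card padic \<Rightarrow> 'p padic" where
  "padic_tan x = padic_sin x / padic_cos x"

definition q_bracket :: "'a::field \<Rightarrow> nat \<Rightarrow> 'a" where
  "q_bracket q n = (1 - q ^ n) / (1 - q)"

(* The integrals only involve the values of f on the naturals. They are total, with an
   unspecified value if the limit does not exist; existence of the limit is recorded by
   padic_q_integrable and padic_fermionic_integrable. *)

definition padic_q_integral_seq ::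
    "'p::prime_card padic \<Rightarrow> ('p padic \<Rightarrow> 'p padic) \<Rightarrow> nat \<Rightarrow> 'p padic" where
  "padic_q_integral_seq q f N =
     1 / q_bracket q (CARD('p) ^ N) * (\<Sum>x<CARD('p) ^ N. f (of_nat x) * q ^ x)"

definition padic_q_integrable :: "'p::prime_card padic \<Rightarrow> ('p padic \<Rightarrow> 'p padic) \<Rightarrow> bool" where
  "padic_q_integrable q f \<longleftrightarrow> convergent (padic_q_integral_seq q f)"

definition padic_q_integral :: "'p::prime_card padic \<Rightarrow> ('p padic \<Rightarrow> 'p padic) \<Rightarrow> 'p padic" where
  "padic_q_integral q f = lim (padic_q_integral_seq q f)"

definition padic_fermionic_integral_seq ::
    "('p::prime_card padic \<Rightarrow> 'p padic) \<Rightarrow> nat \<Rightarrow> 'p padic" where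
  "padic_fermionic_integral_seq f N = (\<Sum>x<CARD('p) ^ N. f (of_nat x) * (-1) ^ x)"

definition padic_fermionic_integrable :: "('p::prime_card padic \<Rightarrow> 'p padic) \<Rightarrow> bool" where
  "padic_fermionic_integrable f \<longleftrightarrow> convergent (padic_fermionic_integral_seq f)"

definition padic_fermionic_integral :: "('p::prime_card padic \<Rightarrow> 'p padic) \<Rightarrow> 'p padic" where
  "padic_fermionic_integral f = lim (padic_fermionic_integral_seq f)"

definition euler_number :: "nat \<Rightarrow> rat" where
  "euler_number n = fact n * fps_nth (2 / (fps_exp 1 + 1)) n"

end

(* For |q + 1| < 1 the sums of a bounded 1-Lipschitz function over {0,...,p^N - 1} with weights q^x
   form a Cauchy sequence, and replacing q by -1 changes them by at most |q + 1|; this gives the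
   existence of the integrals and the limit q -> -1.  Write I for the fermionic integral.  Summation
   by parts yields I(f(x + 1)) = 2 f(0) - I(f).  Applied to sin(ax) and cos(ax), with the addition
   theorems, this is a linear system whose solution is I(cos(ax)) = 1 and I(sin(ax)) = -tan(a/2).
   Applied to x^n, it is the recurrence of the Euler numbers, so I(x^n) = E_n, and integrating the
   sine series termwise gives the expansion.  All series are controlled by
   |x^n / n!| <= p^(-n/2) for |x| < 1. *)

theory Submission
  imports Defs
begin

subsection \<open>The \<open>p\<close>-adic norm and topology\<close>

text \<open>The bound on |x^n / n!| has two sources. The value group is discrete, so |x| < 1 already
  means |x| <= 1/p; and v(n!) <= n/2 because p >= 3. Convergence of the sine series at a in Z_p
  forces |a| < 1, so every argument a x lies in this disc, and so does a/2 because 2 is a unit. The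
  same unit tames the q-integrals: 1 - q^(p^N) is close to 2, hence
  \<open>q_bracket q (CARD('p) ^ N)\<close> has norm 1 and the normalisation puts no powers of p
  into denominators. This is why Lipschitz control of the integrand is the working notion. Q_p is
  not a real normed space, so Cauchy products, term-by-term bounds and the exchange of sum and
  integral are derived from the ultrametric inequality, under which a sum is at most as large as its
  largest term. The addition theorems are inherited from the formal series \<open>fps_sin\<close>
  and \<open>fps_cos\<close>.\<close>

lemma padic_norm_1 [simp]: "padic_norm (1 :: 'p::prime_card padic) = 1"
  using padic_norm_of_nat[of 1, where 'p = 'p] by (simp add: prime_card)

lemma padic_norm_pos_iff [simp]: "padic_norm (x :: 'p::prime_card padic) > 0 \<longleftrightarrow> x \<noteq> 0"
  using padic_norm_nonneg[of x] padic_norm_eq_0_iff[of x] by linarith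

lemma padic_norm_power: "padic_norm (x ^ n :: 'p::prime_card padic) = padic_norm x ^ n"
  by (induction n) (simp_all add: padic_norm_mult)

lemma padic_norm_inverse: "padic_norm (inverse x :: 'p::prime_card padic) = inverse (padic_norm x)"
proof (cases "x = 0")
  case False
  then have "padic_norm x * padic_norm (inverse x) = 1"
    by (simp flip: padic_norm_mult)
  then show ?thesis by (metis inverse_unique)
qed simp

lemma padic_norm_divide: "padic_norm (x / y :: 'p::prime_card padic) = padic_norm x / padic_norm y"
  by (simp add: divide_inverse padic_norm_mult padic_norm_inverse)

lemma padic_norm_minus_commute: "padic_norm (x - y :: 'p::prime_card padic) = padic_norm (y - x)"
  using padic_norm_minus[of "x - y"] by simp

lemma padic_norm_add_le:
  "padic_norm (x :: 'p::prime_card padic) \<le> B \<Longrightarrow> padic_norm y \<le> B \<Longrightarrow> padic_norm (x + y) \<le> B"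
  using padic_norm_add_le_max[of x y] by simp

lemma padic_norm_diff_le:
  "padic_norm (x :: 'p::prime_card padic) \<le> B \<Longrightarrow> padic_norm y \<le> B \<Longrightarrow> padic_norm (x - y) \<le> B"
  using padic_norm_diff_le_max[of x y] by simp

lemma padic_norm_sum_le:
  assumes "B \<ge> 0" "\<And>i. i \<in> A \<Longrightarrow> padic_norm (f i :: 'p::prime_card padic) \<le> B"
  shows "padic_norm (sum f A) \<le> B"
  using assms(2)
  by (induction A rule: infinite_finite_induct) (auto intro: padic_norm_add_le simp: assms(1))

lemma padic_norm_prod:
  "padic_norm (prod f A :: 'p::prime_card padic) = (\<Prod>i\<in>A. padic_norm (f i))"
  by (induction A rule: infinite_finite_induct) (auto simp: padic_norm_mult)

text \<open>Isosceles principle: by the ultrametric inequality a perturbation strictly smaller than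
  y cannot change its norm.\<close>

lemma padic_norm_eq_of_diff_less:
  assumes "padic_norm (x - y :: 'p::prime_card padic) < padic_norm y"
  shows "padic_norm x = padic_norm y"
  using padic_norm_add_le_max[of "x - y" y] padic_norm_diff_le_max[of x "x - y"] assms by auto

lemma padic_norm_of_nat_le_1: "padic_norm (of_nat n :: 'p::prime_card padic) \<le> 1"
  by (induction n) (auto intro: padic_norm_add_le)

lemma padic_norm_of_nat_eq_1:
  assumes "\<not> CARD('p) dvd n"
  shows "padic_norm (of_nat n :: 'p::prime_card padic) = 1"
proof -
  have "\<not> int CARD('p) dvd int n" using assms by (metis of_nat_dvd_iff)
  moreover have "n \<noteq> 0" using assms by (metis dvd_0_right)
  ultimately show ?thesis
    using padic_abs_of_int_div[of "CARD('p)" "int n" 1] prime_card[where 'a = 'p]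
    by (simp add: padic_norm_of_nat not_dvd_imp_multiplicity_0)
qed

lemma padic_norm_CARD: "padic_norm (of_nat CARD('p) :: 'p::prime_card padic) = 1 / real CARD('p)"
proof -
  have "prime (int CARD('p))" using prime_card[where 'a = 'p] by simp
  then have "multiplicity (int CARD('p)) (int CARD('p)) = 1"
    by (intro multiplicity_self) auto
  then show ?thesis
    using padic_abs_of_int_div[of "CARD('p)" "int CARD('p)" 1] prime_card[where 'a = 'p]
    by (simp add: padic_norm_of_nat power_int_minus divide_inverse)
qed

lemma padic_norm_2:
  assumes "odd CARD('p)"
  shows "padic_norm (2 :: 'p::prime_card padic) = 1"
proof -
  have "CARD('p) \<ge> 2" using prime_card[where 'a = 'p] by (rule prime_ge_2_nat)
  then have "\<not> CARD('p) dvd 2" using assms by (metis dvd_imp_le le_antisym dvd_refl zero_less_numeral)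
  from padic_norm_of_nat_eq_1[OF this] show ?thesis by simp
qed

text \<open>The value group is discrete: \<open>x\<close> has the same norm as a sufficiently close rational.\<close>

lemma padic_norm_le_of_less_1:
  assumes "padic_norm (x :: 'p::prime_card padic) < 1"
  shows "padic_norm x \<le> 1 / real CARD('p)"
proof (cases "x = 0")
  case False
  then have "padic_norm x > 0" by simp
  then obtain r where "dist x (of_rat r) < padic_norm x" using padic_rat_dense by blast
  then have "padic_norm (of_rat r - x) < padic_norm x"
    by (simp add: dist_padic_def padic_norm_minus_commute)
  then have r: "padic_norm x = padic_abs CARD('p) r"
    using padic_norm_eq_of_diff_less[of "of_rat r" x] by (simp add: padic_norm_of_rat)
  obtain k where k: "padic_abs CARD('p) r = real CARD('p) powi k"
    using False r by (auto simp: padic_abs_def split: prod.splits if_splits)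
  have p: "real CARD('p) > 1" using prime_card[where 'a = 'p] prime_gt_1_nat by auto
  have "k < 0"
  proof (rule ccontr)
    assume "\<not> k < 0"
    then have "real CARD('p) powi k \<ge> 1" using p one_le_power_int by force
    then show False using assms r k by simp
  qed
  then have "real CARD('p) powi k \<le> real CARD('p) powi (-1)"
    using p by (intro power_int_increasing) auto
  then show ?thesis using r k by (simp add: power_int_minus divide_inverse)
qed simp

section \<open>Continuity of addition and multiplication\<close>

instance padic :: (prime_card) topological_ab_group_add
proof
  fix a b :: "'a padic"
  let ?F = "nhds a \<times>\<^sub>F nhds b"
  have "((\<lambda>x. dist (fst x) a + dist (snd x) b) \<longlongrightarrow> 0) ?F"
    using tendsto_add[OF iffD1[OF tendsto_dist_iff filtermap_fst_prod_filter[folded filterlim_def]]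
        iffD1[OF tendsto_dist_iff filtermap_snd_prod_filter[folded filterlim_def]]] by simp
  then have "((\<lambda>x. dist (fst x + snd x) (a + b)) \<longlongrightarrow> 0) ?F"
  proof (rule tendsto_sandwich[OF _ _ tendsto_const, rotated 2])
    have "dist (x + y) (a + b) \<le> dist x a + dist y b" for x y :: "'a padic"
      unfolding dist_padic_def add_diff_add by (rule padic_norm_add_le) simp_all
    then show "\<forall>\<^sub>F x in ?F. dist (fst x + snd x) (a + b) \<le> dist (fst x) a + dist (snd x) b"
      by (intro always_eventually allI)
  qed simp
  then show "LIM x ?F. fst x + snd x :> nhds (a + b)" by (rule iffD2[OF tendsto_dist_iff])
next
  fix a :: "'a padic"
  have "dist (- x) (- a) = dist x a" for x :: "'a padic"
    using padic_norm_minus[of "x - a"] by (simp add: dist_padic_def)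
  moreover have "((\<lambda>x. dist x a) \<longlongrightarrow> 0) (nhds a)"
    by (rule iffD1[OF tendsto_dist_iff filterlim_ident])
  ultimately have "((\<lambda>x. dist (- x) (- a)) \<longlongrightarrow> 0) (nhds a)" by simp
  then show "(uminus \<longlongrightarrow> - a) (nhds a)" by (rule iffD2[OF tendsto_dist_iff])
qed

instance padic :: (prime_card) topological_semigroup_mult
proof
  fix a b :: "'a padic"
  let ?F = "nhds a \<times>\<^sub>F nhds b"
  \<comment> \<open>The majorant bounds the three terms of xy - ab = (x - a)(y - b) + a(y - b) + (x
    - a)b.\<close>
  have "((\<lambda>x. dist (fst x) a * dist (snd x) b + padic_norm a * dist (snd x) b +
      dist (fst x) a * padic_norm b) \<longlongrightarrow> 0 * 0 + padic_norm a * 0 + 0 * padic_norm b) ?F"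
    by (intro tendsto_add tendsto_mult tendsto_const iffD1[OF tendsto_dist_iff] filtermap_fst_prod_filter[folded filterlim_def] filtermap_snd_prod_filter[folded filterlim_def])
  then have "((\<lambda>x. dist (fst x) a * dist (snd x) b + padic_norm a * dist (snd x) b +
      dist (fst x) a * padic_norm b) \<longlongrightarrow> 0) ?F" by simp
  then have "((\<lambda>x. dist (fst x * snd x) (a * b)) \<longlongrightarrow> 0) ?F"
  proof (rule tendsto_sandwich[OF _ _ tendsto_const, rotated 2])
    have "dist (x * y) (a * b) \<le> dist x a * dist y b + padic_norm a * dist y b + dist x a * padic_norm b"
      (is "_ \<le> ?B") for x y :: "'a padic"
    proof -
      have "padic_norm ((x - a) * (y - b) + a * (y - b) + (x - a) * b) \<le> ?B"
        by (intro padic_norm_add_le) (simp_all add: padic_norm_mult dist_padic_def)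
      then show ?thesis by (simp add: dist_padic_def algebra_simps)
    qed
    then show "\<forall>\<^sub>F x in ?F. dist (fst x * snd x) (a * b) \<le>
        dist (fst x) a * dist (snd x) b + padic_norm a * dist (snd x) b + dist (fst x) a * padic_norm b"
      by (intro always_eventually allI)
  qed simp
  then show "LIM x ?F. fst x * snd x :> nhds (a * b)" by (rule iffD2[OF tendsto_dist_iff])
qed

section \<open>Limits and series under the ultrametric inequality\<close>

lemma padic_LIMSEQ_iff:
  "X \<longlonglongrightarrow> (L :: 'p::prime_card padic) \<longleftrightarrow> (\<lambda>n. padic_norm (X n - L)) \<longlonglongrightarrow> 0"
  by (subst tendsto_dist_iff) (simp add: dist_padic_def)

lemma padic_LIMSEQ_I:
  assumes "\<And>n. padic_norm (X n - L :: 'p::prime_card padic) \<le> B n" "B \<longlonglongrightarrow> 0"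
  shows "X \<longlonglongrightarrow> L"
  unfolding padic_LIMSEQ_iff
  by (rule tendsto_sandwich[OF _ _ tendsto_const assms(2)]) (simp_all add: assms(1))

lemma padic_norm_LIMSEQ_le:
  assumes "X \<longlonglongrightarrow> (L :: 'p::prime_card padic)" "\<And>n. n \<ge> N \<Longrightarrow> padic_norm (X n) \<le> B"
  shows "padic_norm L \<le> B"
proof (rule LIMSEQ_le_const2)
  show "(\<lambda>n. padic_norm (X n)) \<longlonglongrightarrow> padic_norm L"
    using tendsto_dist[OF assms(1) tendsto_const[of 0]] by (simp add: dist_padic_def)
qed (use assms(2) in blast)

text \<open>The distance between two late terms is at most the largest step between them, not the
  sum of the steps, so steps tending to 0 already give a Cauchy sequence; completeness does the
  rest.\<close>

lemma padic_convergent_of_step: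
  fixes X :: "nat \<Rightarrow> 'p::prime_card padic"
  assumes "\<And>n. padic_norm (X (Suc n) - X n) \<le> B n" "B \<longlonglongrightarrow> 0"
  shows "convergent X"
proof (rule Cauchy_convergent, rule metric_CauchyI)
  fix e :: real assume e: "e > 0"
  obtain N where N: "\<And>n. n \<ge> N \<Longrightarrow> B n < e / 2"
    using order_tendstoD(2)[OF assms(2), of "e / 2"] e by (auto simp: eventually_sequentially)
  have N': "padic_norm (X n - X N) \<le> e / 2" if "n \<ge> N" for n
    using that
  proof (induction n rule: dec_induct)
    case (step n)
    have "padic_norm ((X (Suc n) - X n) + (X n - X N)) \<le> e / 2"
      using step assms(1)[of n] N[of n] by (intro padic_norm_add_le) auto
    then show ?case by simp
  qed (use e in simp)
  show "\<exists>M. \<forall>m\<ge>M. \<forall>n\<ge>M. dist (X m) (X n) < e"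
  proof (intro exI allI impI)
    fix m n assume mn: "m \<ge> N" "n \<ge> N"
    have "padic_norm ((X m - X N) - (X n - X N)) \<le> e / 2"
      by (rule padic_norm_diff_le[OF N'[OF mn(1)] N'[OF mn(2)]])
    then show "dist (X m) (X n) < e" using e by (simp add: dist_padic_def padic_diff_diff_cancel)
  qed
qed

lemma padic_summable_geometric:
  fixes c :: "nat \<Rightarrow> 'p::prime_card padic"
  assumes "\<And>n. padic_norm (c n) \<le> r ^ n" "0 \<le> r" "r < 1"
  shows "summable c"
  unfolding summable_iff_convergent
  by (rule padic_convergent_of_step[of _ "\<lambda>n. r ^ n"])
    (use assms in \<open>auto intro: LIMSEQ_power_zero\<close>)

text \<open>A finite piece of the tail is bounded by its largest term, and closed balls are closed
  under limits. K = 0 bounds a whole sum, K = 1 its distance from the constant term, and general K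
  is used for truncation.\<close>

lemma padic_sums_tail_le:
  fixes c :: "nat \<Rightarrow> 'p::prime_card padic"
  assumes "c sums s" "\<And>n. n \<ge> K \<Longrightarrow> padic_norm (c n) \<le> B" "B \<ge> 0"
  shows "padic_norm (s - (\<Sum>n<K. c n)) \<le> B"
proof (rule padic_norm_LIMSEQ_le)
  show "(\<lambda>N. (\<Sum>n<N. c n) - (\<Sum>n<K. c n)) \<longlonglongrightarrow> s - (\<Sum>n<K. c n)"
    using assms(1) by (intro tendsto_diff tendsto_const) (simp add: sums_def)
  fix N assume "N \<ge> K"
  then have "(\<Sum>n<N. c n) - (\<Sum>n<K. c n) = (\<Sum>n\<in>{K..<N}. c n)"
    by (simp add: sum_diff_nat_ivl flip: atLeast0LessThan)
  then show "padic_norm ((\<Sum>n<N. c n) - (\<Sum>n<K. c n)) \<le> B"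
    using assms(2,3) by (auto intro: padic_norm_sum_le)
qed

text \<open>Partial sums of even length form a subsequence, so dropping the zero terms needs no
  rearrangement. This links \<open>fps_sin\<close>, indexed by exponents, with series indexed by
  n.\<close>

lemma sums_odd_part:
  fixes c :: "nat \<Rightarrow> 'a::{topological_space, comm_monoid_add}"
  assumes "c sums s" "\<And>n. c (2 * n) = 0"
  shows "(\<lambda>n. c (2 * n + 1)) sums s"
proof -
  have "(\<Sum>n<2 * K. c n) = (\<Sum>n<K. c (2 * n + 1))" for K
    by (induction K) (simp_all add: assms(2))
  moreover have "strict_mono (\<lambda>K::nat. 2 * K)" by (simp add: strict_mono_def)
  ultimately show ?thesis
    using LIMSEQ_subseq_LIMSEQ[of "\<lambda>N. \<Sum>n<N. c n" s "\<lambda>K. 2 * K"] assms(1)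
    by (simp add: sums_def o_def)
qed

lemma sums_even_part:
  fixes c :: "nat \<Rightarrow> 'a::{topological_space, comm_monoid_add}"
  assumes "c sums s" "\<And>n. c (2 * n + 1) = 0"
  shows "(\<lambda>n. c (2 * n)) sums s"
proof -
  have "(\<Sum>n<2 * K. c n) = (\<Sum>n<K. c (2 * n))" for K
    using assms(2) by (induction K) simp_all
  moreover have "strict_mono (\<lambda>K::nat. 2 * K)" by (simp add: strict_mono_def)
  ultimately show ?thesis
    using LIMSEQ_subseq_LIMSEQ[of "\<lambda>N. \<Sum>n<N. c n" s "\<lambda>K. 2 * K"] assms(1)
    by (simp add: sums_def o_def)
qed

text \<open>The product of the K-th partial sums and the K-th partial sum of the Cauchy product
  differ only by pairs with i, j < K and i + j >= K. Each such term is at most r^(i+j) <= r^K, hence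
  so is their sum, however many pairs there are.\<close>

lemma padic_fps_mult_sums:
  fixes F G :: "'p::prime_card padic fps"
  assumes F: "\<And>n. padic_norm (fps_nth F n) \<le> r ^ n" and G: "\<And>n. padic_norm (fps_nth G n) \<le> r ^ n"
    and r: "0 \<le> r" "r < 1" and "fps_nth F sums s" "fps_nth G sums t"
  shows "fps_nth (F * G) sums (s * t)"
proof -
  let ?f = "fps_nth F" and ?g = "fps_nth G"
  define D where "D K = (\<Sum>i<K. ?f i) * (\<Sum>j<K. ?g j) - (\<Sum>n<K. fps_nth (F * G) n)" for K
  have "padic_norm (D K - 0) \<le> r ^ K" for K
  proof -
    let ?h = "\<lambda>(i, j). ?f i * ?g j" and ?T = "{(i, j). i + j < K}"
    have "(\<Sum>i<K. ?f i) * (\<Sum>j<K. ?g j) = sum ?h ({..<K} \<times> {..<K})"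
      by (simp add: sum_product sum.cartesian_product)
    moreover have "(\<Sum>n<K. fps_nth (F * G) n) = sum ?h ?T"
      by (simp add: sum.triangle_reindex fps_mult_nth atLeast0AtMost)
    moreover have "?T \<subseteq> {..<K} \<times> {..<K}" by auto
    ultimately have D: "D K = sum ?h ({..<K} \<times> {..<K} - ?T)"
      by (simp add: D_def sum_diff)
    have "padic_norm (?h x) \<le> r ^ K" if "x \<in> {..<K} \<times> {..<K} - ?T" for x
    proof -
      obtain i j where x: "x = (i, j)" by (cases x)
      have "padic_norm (?h x) \<le> r ^ i * r ^ j"
        using F G r unfolding x by (simp add: padic_norm_mult mult_mono)
      also have "\<dots> \<le> r ^ K" unfolding power_add[symmetric]
        using that x r by (intro power_decreasing) auto
      finally show ?thesis .
    qed
    then show ?thesis unfolding D diff_zero using r by (intro padic_norm_sum_le) auto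
  qed
  then have D: "D \<longlonglongrightarrow> 0"
    by (rule padic_LIMSEQ_I) (use r in \<open>auto intro: LIMSEQ_power_zero\<close>)
  have "(\<lambda>K. (\<Sum>i<K. ?f i) * (\<Sum>j<K. ?g j) - D K) \<longlonglongrightarrow> s * t - 0"
    using assms(5,6) by (intro tendsto_diff tendsto_mult D) (simp_all add: sums_def)
  then show ?thesis by (simp add: sums_def D_def)
qed

subsection \<open>Sine and cosine\<close>

text \<open>One step of Legendre's formula: only the multiples of p up to n have norm below 1, and
  writing them as p j leaves one factor p for each j <= n div p, times (n div p)!.\<close>

lemma padic_norm_fact_div:
  "padic_norm (fact n :: 'p::prime_card padic) =
     (1 / real CARD('p)) ^ (n div CARD('p)) * padic_norm (fact (n div CARD('p)) :: 'p padic)"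
proof -
  let ?p = "CARD('p)" and ?N = "\<lambda>i. padic_norm (of_nat i :: 'p padic)"
  have p: "?p > 0" by simp
  have fact: "padic_norm (fact m :: 'p padic) = (\<Prod>i\<in>{1..m}. ?N i)" for m
    by (simp add: fact_prod padic_norm_prod)
  have "(\<Prod>i\<in>{1..n}. ?N i) = (\<Prod>i\<in>{i\<in>{1..n}. ?p dvd i}. ?N i)"
    by (rule prod.mono_neutral_right) (auto simp: padic_norm_of_nat_eq_1)
  also have "\<dots> = (\<Prod>j\<in>{1..n div ?p}. ?N (?p * j))"
  proof (rule prod.reindex_bij_witness[of _ "\<lambda>j. ?p * j" "\<lambda>i. i div ?p"])
    fix j assume "j \<in> {1..n div ?p}"
    then show "?p * j \<in> {i \<in> {1..n}. ?p dvd i}"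
      using p by (auto simp: less_eq_div_iff_mult_less_eq mult.commute Suc_le_eq)
  qed (auto simp: div_le_mono dvd_div_eq_mult Suc_le_eq div_greater_zero_iff dvd_imp_le)
  also have "\<dots> = (1 / real ?p) ^ (n div ?p) * (\<Prod>j\<in>{1..n div ?p}. ?N j)"
    by (simp add: padic_norm_mult padic_norm_CARD prod.distrib prod_dividef power_one_over)
  finally show ?thesis by (simp only: fact)
qed

text \<open>This is v(n!) <= n/2, squared to avoid half-integral exponents. With m = n div p,
  induction gives 2 v(n!) = 2m + 2 v(m!) <= 3m <= p m <= n.\<close>

lemma padic_norm_fact_ge:
  assumes "odd CARD('p::prime_card)"
  shows "(1 / real CARD('p)) ^ n \<le> (padic_norm (fact n :: 'p padic))\<^sup>2"
proof (induction n rule: less_induct)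
  case (less n)
  let ?p = "CARD('p)" let ?m = "n div ?p"
  have p: "?p \<ge> 3"
  proof -
    have "?p \<ge> 2" using prime_card[where 'a = 'p] by (rule prime_ge_2_nat)
    then show ?thesis using assms by (cases "?p = 2") auto
  qed
  show ?case
  proof (cases "n = 0")
    case False
    have "3 * ?m \<le> ?p * ?m" using p by (rule mult_right_mono) simp
    also have "\<dots> \<le> n" by simp
    finally have "(1 / real ?p) ^ n \<le> (1 / real ?p) ^ (3 * ?m)"
      using p by (intro power_decreasing) auto
    also have "\<dots> = ((1 / real ?p) ^ ?m)\<^sup>2 * (1 / real ?p) ^ ?m"
      by (simp add: power_add[symmetric] power_mult[symmetric])
    also have "\<dots> \<le> ((1 / real ?p) ^ ?m)\<^sup>2 * (padic_norm (fact ?m :: 'p padic))\<^sup>2"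
      using less.IH[of ?m] False p by (intro mult_left_mono) auto
    also have "\<dots> = (padic_norm (fact n :: 'p padic))\<^sup>2"
      by (simp add: padic_norm_fact_div[of n] power_mult_distrib)
    finally show ?thesis .
  qed simp
qed

text \<open>For r = p^(-1/2), discreteness gives |x| <= r^2 and the factorial estimate gives |n!| >=
  r^n, which leaves r^(2n) / r^n. The rate r is independent of x, so that series with different
  arguments can be multiplied.\<close>

lemma padic_exp_coeff_le:
  assumes "odd CARD('p::prime_card)"
  obtains r where "0 \<le> r" "r < 1"
    "\<And>(x :: 'p padic) n. padic_norm x < 1 \<Longrightarrow> padic_norm (x ^ n / fact n) \<le> r ^ n"
proof
  let ?r = "1 / sqrt (real CARD('p))"
  have p: "CARD('p) > 1" using prime_card[where 'a = 'p] by (rule prime_gt_1_nat)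
  show "0 \<le> ?r" "?r < 1" using p by auto
  fix x :: "'p padic" and n assume "padic_norm x < 1"
  then have x: "padic_norm x \<le> ?r * ?r"
    using padic_norm_le_of_less_1[of x] by simp
  have "(?r ^ n)\<^sup>2 = (1 / real CARD('p)) ^ n"
    by (simp add: power2_eq_square flip: power_mult_distrib)
  then have "?r ^ n \<le> padic_norm (fact n :: 'p padic)"
    using padic_norm_fact_ge[OF assms, of n] by (intro power2_le_imp_le[of "?r ^ n"]) simp_all
  then have "?r ^ n * ?r ^ n \<le> ?r ^ n * padic_norm (fact n :: 'p padic)"
    by (rule mult_left_mono) simp
  then have "padic_norm x ^ n \<le> ?r ^ n * padic_norm (fact n :: 'p padic)"
    unfolding power_mult_distrib[symmetric] by (rule order.trans[OF power_mono[OF x padic_norm_nonneg]])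
  moreover have "padic_norm (fact n :: 'p padic) > 0"
    by simp
  ultimately show "padic_norm (x ^ n / fact n) \<le> ?r ^ n"
    by (simp add: padic_norm_divide padic_norm_power pos_divide_le_eq)
qed

section \<open>Evaluating the formal sine and cosine series\<close>

lemma padic_norm_fps_sin_le: "padic_norm (fps_nth (fps_sin x) n) \<le> padic_norm (x ^ n / fact n :: 'p::prime_card padic)"
  by (simp add: fps_sin_def padic_norm_divide padic_norm_mult padic_norm_power)

lemma padic_norm_fps_cos_le: "padic_norm (fps_nth (fps_cos x) n) \<le> padic_norm (x ^ n / fact n :: 'p::prime_card padic)"
  by (simp add: fps_cos_def padic_norm_divide padic_norm_mult padic_norm_power)

text \<open>Makes sin(a x) a power series in x with the coefficients of \<open>fps_sin a\<close>,
  the form required for Lipschitz bounds and termwise integration.\<close>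

lemma fps_sin_nth_power: "fps_nth (fps_sin (a * x)) n = fps_nth (fps_sin a) n * x ^ n"
  by (simp add: fps_sin_def power_mult_distrib)

lemma fps_cos_nth_power: "fps_nth (fps_cos (a * x)) n = fps_nth (fps_cos a) n * x ^ n"
  by (simp add: fps_cos_def power_mult_distrib)

lemma
  fixes x :: "'p::prime_card padic"
  assumes "odd CARD('p)" "padic_norm x < 1"
  shows padic_sin_sums: "fps_nth (fps_sin x) sums padic_sin x"
    and padic_cos_sums: "fps_nth (fps_cos x) sums padic_cos x"
    and padic_sin_domainI: "x \<in> padic_sin_domain"
    and padic_cos_domainI: "x \<in> padic_cos_domain"
proof -
  obtain r where r: "0 \<le> r" "r < 1" "\<And>n. padic_norm (x ^ n / fact n) \<le> r ^ n"
    using padic_exp_coeff_le[OF assms(1)] assms(2) by metis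
  obtain s where s: "fps_nth (fps_sin x) sums s"
    using padic_summable_geometric[OF order.trans[OF padic_norm_fps_sin_le r(3)] r(1,2)]
    by (auto simp: summable_def)
  then have "(\<lambda>n. fps_nth (fps_sin x) (2 * n + 1)) sums s"
    by (rule sums_odd_part) (simp add: fps_sin_def)
  then have s': "padic_sin_term x sums s"
    by (simp add: fps_sin_def padic_sin_term_def[abs_def] del: fact_Suc)
  obtain c where c: "fps_nth (fps_cos x) sums c"
    using padic_summable_geometric[OF order.trans[OF padic_norm_fps_cos_le r(3)] r(1,2)]
    by (auto simp: summable_def)
  then have "(\<lambda>n. fps_nth (fps_cos x) (2 * n)) sums c"
    by (rule sums_even_part) (simp add: fps_cos_def)
  then have c': "padic_cos_term x sums c"
    by (simp add: fps_cos_def padic_cos_term_def[abs_def])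
  show "fps_nth (fps_sin x) sums padic_sin x" "fps_nth (fps_cos x) sums padic_cos x"
    "x \<in> padic_sin_domain" "x \<in> padic_cos_domain"
    using s s' c c' sums_unique[OF s'] sums_unique[OF c']
    by (auto simp: padic_sin_def padic_cos_def padic_sin_domain_def padic_cos_domain_def summable_def)
qed

text \<open>\<open>fps_sin x\<close> is the formal series of sin(x T), so summing its coefficients
  evaluates it at T = 1. The formal addition theorems and the formal sum of squares thus become
  identities of values, once products are known to sum correctly.\<close>

lemma
  fixes x y :: "'p::prime_card padic"
  assumes p: "odd CARD('p)" and x: "padic_norm x < 1" and y: "padic_norm y < 1"
  shows padic_sin_add: "padic_sin (x + y) = padic_sin x * padic_cos y + padic_cos x * padic_sin y"
    and padic_cos_add: "padic_cos (x + y) = padic_cos x * padic_cos y - padic_sin x * padic_sin y"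
    and padic_sin_cos_squared: "padic_cos x * padic_cos x + padic_sin x * padic_sin x = 1"
proof -
  obtain r where r: "0 \<le> r" "r < 1"
    "\<And>(z :: 'p padic) n. padic_norm z < 1 \<Longrightarrow> padic_norm (z ^ n / fact n) \<le> r ^ n"
    using padic_exp_coeff_le[OF p] by metis
  have xy: "padic_norm (x + y) < 1"
    using padic_norm_add_le_max[of x y] x y by simp
  note le = order.trans[OF padic_norm_fps_sin_le r(3)] order.trans[OF padic_norm_fps_cos_le r(3)]
  note S = padic_sin_sums[OF p] and C = padic_cos_sums[OF p]
  have SC: "fps_nth (fps_sin z * fps_cos w) sums (padic_sin z * padic_cos w)"
    and SS: "fps_nth (fps_sin z * fps_sin w) sums (padic_sin z * padic_sin w)"
    and CS: "fps_nth (fps_cos z * fps_sin w) sums (padic_cos z * padic_sin w)"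
    and CC: "fps_nth (fps_cos z * fps_cos w) sums (padic_cos z * padic_cos w)"
    if "padic_norm z < 1" "padic_norm w < 1" for z w :: "'p padic"
    by (rule padic_fps_mult_sums[where r = r]; use that r(1,2) le S C in blast)+
  have add: "fps_nth (F + G) sums (s + t)" and diff: "fps_nth (F - G) sums (s - t)"
    if "fps_nth F sums s" "fps_nth G sums t" for F G :: "'p padic fps" and s t
    using that tendsto_add tendsto_diff
    by (fastforce simp: sums_def sum.distrib sum_subtractf)+
  show "padic_sin (x + y) = padic_sin x * padic_cos y + padic_cos x * padic_sin y"
    using S[OF xy] add[OF SC[OF x y] CS[OF x y]] by (simp add: fps_sin_add sums_unique2)
  show "padic_cos (x + y) = padic_cos x * padic_cos y - padic_sin x * padic_sin y"
    using C[OF xy] diff[OF CC[OF x y] SS[OF x y]] by (simp add: fps_cos_add sums_unique2)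
  have "fps_nth (1 :: 'p padic fps) = (\<lambda>n. if n = 0 then 1 else 0)" by (simp add: fun_eq_iff)
  then have "fps_nth (1 :: 'p padic fps) sums 1"
    using sums_single[of 0 "\<lambda>_. 1 :: 'p padic"] by simp
  then show "padic_cos x * padic_cos x + padic_sin x * padic_sin x = 1"
    using add[OF CC[OF x x] SS[OF x x]] fps_sin_cos_sum_of_squares[of x]
    by (simp add: power2_eq_square sums_unique2)
qed

lemma padic_sin_0 [simp]: "padic_sin 0 = 0"
  by (simp add: padic_sin_def padic_sin_term_def)

lemma padic_cos_0 [simp]: "padic_cos 0 = 1"
  unfolding padic_cos_def by (subst suminf_finite[of "{0}"]) (simp_all add: padic_cos_term_def)

text \<open>All terms after the leading 1 have norm at most r < 1, so cos x lies in the open unit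
  ball around 1, which omits 0.\<close>

lemma padic_cos_nonzero:
  fixes x :: "'p::prime_card padic"
  assumes p: "odd CARD('p)" and x: "padic_norm x < 1"
  shows "padic_cos x \<noteq> 0"
proof -
  obtain r where r: "0 \<le> r" "r < 1" "\<And>n. padic_norm (x ^ n / fact n) \<le> r ^ n"
    using padic_exp_coeff_le[OF p] x by metis
  have "padic_norm (fps_nth (fps_cos x) n) \<le> r" if "n \<ge> 1" for n
  proof -
    have "padic_norm (fps_nth (fps_cos x) n) \<le> r ^ n"
      using padic_norm_fps_cos_le r(3) by (rule order.trans)
    also have "\<dots> \<le> r ^ 1" using that r by (intro power_decreasing) auto
    finally show ?thesis by simp
  qed
  from padic_sums_tail_le[OF padic_cos_sums[OF p x], of 1, OF this r(1)]
  have "padic_norm (padic_cos x - 1) < 1" using r(2) by simp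
  then show ?thesis by auto
qed

text \<open>If |a| = 1, the n-th sine term has norm 1 / |(2n+1)!| >= 1 and cannot tend to 0. Thus
  the convergence hypothesis becomes the bound on which all estimates rest.\<close>

lemma padic_norm_less_1_of_sin_domain:
  fixes a :: "'p::prime_card padic"
  assumes "a \<in> padic_ints" "a \<in> padic_sin_domain"
  shows "padic_norm a < 1"
proof (rule ccontr)
  assume "\<not> padic_norm a < 1"
  then have a: "padic_norm a = 1" using assms(1) by (simp add: padic_ints_def)
  obtain s where "(\<lambda>N. \<Sum>n<N. padic_sin_term a n) \<longlonglongrightarrow> s"
    using assms(2) by (auto simp: padic_sin_domain_def summable_def sums_def)
  from tendsto_diff[OF LIMSEQ_Suc[OF this] this]
  have "padic_sin_term a \<longlonglongrightarrow> 0" by simp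
  then have "(\<lambda>n. padic_norm (padic_sin_term a n)) \<longlonglongrightarrow> 0" by (simp add: padic_LIMSEQ_iff)
  from order_tendstoD(2)[OF this, of 1] obtain n where "padic_norm (padic_sin_term a n) < 1"
    by (auto simp: eventually_sequentially)
  moreover have "padic_norm (fact (2 * n + 1) :: 'p padic) \<le> 1"
    using padic_norm_of_nat_le_1[of "fact (2 * n + 1)", where 'p = 'p] by (simp only: of_nat_fact)
  moreover have "padic_norm (fact (2 * n + 1) :: 'p padic) > 0"
    by (simp del: fact_Suc)
  ultimately show False
    by (simp add: padic_sin_term_def padic_norm_divide padic_norm_mult padic_norm_power a
        del: fact_Suc)
qed

subsection \<open>The integrals of Lipschitz functions\<close>

text \<open>Only natural arguments occur, because the integral sums sample f there alone. The
  constants 1 are those of power series with coefficients in Z_p.\<close>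

definition padic_unit_lipschitz :: "('p::prime_card padic \<Rightarrow> 'p padic) \<Rightarrow> bool" where
  "padic_unit_lipschitz f \<longleftrightarrow> (\<forall>n. padic_norm (f (of_nat n)) \<le> 1) \<and>
     (\<forall>m n. padic_norm (f (of_nat m) - f (of_nat n)) \<le> padic_norm (of_nat m - of_nat n :: 'p padic))"

text \<open>In x^n - y^n = (x - y) * (...) the cofactor lies in the unit ball. It serves both to
  compare x^n with y^n for monomials and to compare q^x with (-1)^x.\<close>

lemma padic_norm_power_diff_le:
  fixes x y :: "'p::prime_card padic"
  assumes "padic_norm x \<le> 1" "padic_norm y \<le> 1"
  shows "padic_norm (x ^ n - y ^ n) \<le> padic_norm (x - y)"
proof -
  have "padic_norm (\<Sum>i<n. y ^ (n - Suc i) * x ^ i) \<le> 1"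
    using assms by (intro padic_norm_sum_le) (auto simp: padic_norm_mult padic_norm_power intro!: mult_le_one power_le_one)
  from mult_left_mono[OF this padic_norm_nonneg, of "x - y"] show ?thesis
    by (simp add: power_diff_sumr2 padic_norm_mult)
qed

section \<open>Powers of q near -1\<close>

lemma padic_norm_eq_1_of_near_minus_1:
  assumes "padic_norm (q + 1 :: 'p::prime_card padic) < 1"
  shows "padic_norm q = 1"
  using padic_norm_eq_of_diff_less[of q "-1"] assms by simp

text \<open>1 - q = 2 - (q + 1), where 2 is a unit and q + 1 is strictly smaller. Applied to q and
  to q^(p^N), it makes the bracket a unit.\<close>

lemma padic_norm_one_minus:
  fixes q :: "'p::prime_card padic"
  assumes "odd CARD('p)" "padic_norm (q + 1) < 1"
  shows "padic_norm (1 - q) = 1"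
proof -
  have "padic_norm (1 - q - 2) = padic_norm (q + 1)"
    using padic_norm_minus[of "q + 1"] by (simp add: algebra_simps)
  then show ?thesis
    using padic_norm_eq_of_diff_less[of "1 - q" 2] assms padic_norm_2[OF assms(1)] by simp
qed

lemma padic_norm_power_CARD_plus_1:
  fixes q :: "'p::prime_card padic"
  assumes "odd CARD('p)" "padic_norm (q + 1) < 1"
  shows "padic_norm (q ^ (CARD('p) ^ N) + 1) \<le> padic_norm (q + 1)"
proof -
  have "odd (CARD('p) ^ N)" using assms(1) by simp
  then show ?thesis
    using padic_norm_power_diff_le[of q "-1" "CARD('p) ^ N"] padic_norm_eq_1_of_near_minus_1[OF assms(2)]
    by simp
qed

text \<open>For \<open>u = - q\<close> the claim is that u^(p^N) tends to 1: on the disc around 1,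
  each p-th power shrinks the distance to 1 by the factor \<open>s\<close>.\<close>

lemma padic_power_CARD_plus_1_tendsto:
  fixes q :: "'p::prime_card padic"
  assumes p: "odd CARD('p)" and q: "padic_norm (q + 1) < 1"
  shows "(\<lambda>N. padic_norm (q ^ (CARD('p) ^ N) + 1)) \<longlonglongrightarrow> 0"
proof -
  let ?p = "CARD('p)"
  define u where "u = - q"
  \<comment> \<open>\<open>s\<close> has to dominate both |p| = 1/p and |u - 1|, the two
    contributions to the cofactor of v - 1 in v^p - 1.\<close>
  define s where "s = max (1 / real ?p) (padic_norm (q + 1))"
  have p1: "?p > 1" using prime_card[where 'a = 'p] by (rule prime_gt_1_nat)
  have s: "0 \<le> s" "s < 1" using p1 q by (auto simp: s_def le_max_iff_disj)
  have u1: "padic_norm u = 1" using padic_norm_eq_1_of_near_minus_1[OF q] by (simp add: u_def)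
  have "padic_norm (u - 1) = padic_norm (q + 1)"
    using padic_norm_minus[of "q + 1"] by (simp add: u_def)
  then have us: "padic_norm (u - 1) \<le> s" by (simp add: s_def)
  \<comment> \<open>\<open>v\<^sup>p - 1 = (v - 1) (\<Sum>i<p. v\<^sup>i)\<close>, and the sum is congruent to \<open>p\<close> modulo \<open>v - 1\<close>.\<close>
  have step: "padic_norm (v ^ ?p - 1) \<le> padic_norm (v - 1) * s"
    if v: "padic_norm v = 1" "padic_norm (v - 1) \<le> s" for v :: "'p padic"
  proof -
    have "padic_norm (v ^ i - 1) \<le> s" for i
      using padic_norm_power_diff_le[of v 1 i] v by simp
    then have "padic_norm ((\<Sum>i<?p. v ^ i - 1) + of_nat ?p) \<le> s"
      using s(1) by (intro padic_norm_add_le padic_norm_sum_le) (auto simp: padic_norm_CARD s_def)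
    also have "(\<Sum>i<?p. v ^ i - 1) + of_nat ?p = (\<Sum>i<?p. v ^ i)"
      by (simp add: sum_subtractf)
    finally show ?thesis
      by (simp add: power_diff_1_eq padic_norm_mult mult_left_mono)
  qed
  have bound: "padic_norm (u ^ (?p ^ N) - 1) \<le> s ^ Suc N" for N
  proof (induction N)
    case 0
    then show ?case using us by simp
  next
    case (Suc N)
    have "s ^ Suc N \<le> s" using s by (simp add: mult_left_le power_le_one)
    then have "padic_norm (u ^ (?p ^ N) - 1) \<le> s" using Suc by simp
    then have "padic_norm ((u ^ (?p ^ N)) ^ ?p - 1) \<le> padic_norm (u ^ (?p ^ N) - 1) * s"
      using u1 by (intro step) (simp_all add: padic_norm_power)
    also have "\<dots> \<le> s ^ Suc N * s" using Suc s by (intro mult_right_mono) auto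
    finally show ?case by (simp add: power_mult[symmetric] mult.commute)
  qed
  have "padic_norm (q ^ (?p ^ N) + 1) = padic_norm (u ^ (?p ^ N) - 1)" for N
  proof -
    have "odd (?p ^ N)" using p by simp
    then have "q ^ (?p ^ N) + 1 = - (u ^ (?p ^ N) - 1)" by (simp add: u_def)
    then show ?thesis by (simp only: padic_norm_minus)
  qed
  then have le: "padic_norm (q ^ (?p ^ N) + 1) \<le> s ^ Suc N" for N using bound by simp
  have lim: "(\<lambda>N. s ^ Suc N) \<longlonglongrightarrow> 0"
    by (rule LIMSEQ_Suc[OF LIMSEQ_power_zero]) (use s in simp)
  show ?thesis
    by (rule tendsto_sandwich[OF _ _ tendsto_const lim]; rule always_eventually, rule allI)
      (rule padic_norm_nonneg le)+
qed

text \<open>The sum without its bracket, so that one convergence proof covers the q-integral and, at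
  q = -1, the fermionic integral.\<close>

definition padic_twisted_sum :: "'p::prime_card padic \<Rightarrow> ('p padic \<Rightarrow> 'p padic) \<Rightarrow> nat \<Rightarrow> 'p padic" where
  "padic_twisted_sum q f N = (\<Sum>x<CARD('p) ^ N. f (of_nat x) * q ^ x)"

lemma padic_fermionic_integral_seq_eq: "padic_fermionic_integral_seq f = padic_twisted_sum (-1) f"
  by (simp add: fun_eq_iff padic_fermionic_integral_seq_def padic_twisted_sum_def)

lemma padic_q_integral_seq_eq:
  "padic_q_integral_seq q f N =
     (1 - q) / (1 - q ^ (CARD('p) ^ N)) * padic_twisted_sum q f N" for q :: "'p::prime_card padic"
  by (simp add: padic_q_integral_seq_def padic_twisted_sum_def q_bracket_def)

text \<open>Splitting \<open>{..<p\<^sup>N\<^sup>+\<^sup>1}\<close> into \<open>p\<close> blocks of length \<open>p\<^sup>N\<close>, the \<open>j\<close>-th block contributes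
  approximately \<open>(-1)\<^sup>j\<close> times the sum of level \<open>N\<close>, and \<open>\<Sum>j<p. (-1)\<^sup>j = 1\<close> as \<open>p\<close> is odd.\<close>

lemma padic_twisted_sum_step:
  fixes q :: "'p::prime_card padic"
  assumes p: "odd CARD('p)" and q: "padic_norm (q + 1) < 1" and f: "padic_unit_lipschitz f"
  shows "padic_norm (padic_twisted_sum q f (Suc N) - padic_twisted_sum q f N)
    \<le> max ((1 / real CARD('p)) ^ N) (padic_norm (q ^ (CARD('p) ^ N) + 1))" (is "_ \<le> ?B")
proof -
  let ?p = "CARD('p)"
  define k where "k = ?p ^ N"
  have q1: "padic_norm q = 1" by (rule padic_norm_eq_1_of_near_minus_1[OF q])
  have shift: "(\<Sum>x=m..<m + k. g x) = (\<Sum>y<k. g (y + m))" for m and g :: "nat \<Rightarrow> 'p padic"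
    using sum.shift_bounds_nat_ivl[of g 0 m k] by (simp add: add.commute[of m] atLeast0LessThan)
  have "padic_twisted_sum q f (Suc N) = (\<Sum>x<?p * k. f (of_nat x) * q ^ x)"
    by (simp add: padic_twisted_sum_def k_def)
  also have "\<dots> = (\<Sum>j<?p. \<Sum>x=j * k..<j * k + k. f (of_nat x) * q ^ x)"
    by (rule sum.nat_group[symmetric])
  also have "\<dots> = (\<Sum>j<?p. \<Sum>y<k. f (of_nat (y + j * k)) * q ^ (y + j * k))"
    by (simp only: shift)
  finally have 1: "padic_twisted_sum q f (Suc N) =
    (\<Sum>j<?p. \<Sum>y<k. f (of_nat (y + j * k)) * q ^ (y + j * k))" .
  have "(\<Sum>j<?p. (-1) ^ j) = (1 :: 'p padic)"
  proof -
    have "(\<Sum>j<n. (-1) ^ j) = (if odd n then 1 else 0 :: 'p padic)" for n :: nat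
      by (induction n) auto
    then show ?thesis using p by simp
  qed
  then have 2: "padic_twisted_sum q f N = (\<Sum>j<?p. \<Sum>y<k. f (of_nat y) * q ^ y * (-1) ^ j)"
    by (simp add: padic_twisted_sum_def k_def flip: sum_distrib_left sum_distrib_right)
  have "padic_norm (f (of_nat (y + j * k)) * q ^ (y + j * k) - f (of_nat y) * q ^ y * (-1) ^ j) \<le> ?B"
    for y j
  proof -
    have kB: "padic_norm (of_nat k :: 'p padic) = (1 / real ?p) ^ N"
      by (simp add: k_def padic_norm_power padic_norm_CARD)
    have "padic_norm (f (of_nat (y + j * k)) - f (of_nat y)) \<le> padic_norm (of_nat (j * k) :: 'p padic)"
      using f unfolding padic_unit_lipschitz_def by (metis add_diff_cancel_left' of_nat_add)
    also have "\<dots> \<le> (1 / real ?p) ^ N"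
      using padic_norm_of_nat_le_1[of j, where 'p = 'p] by (simp add: padic_norm_mult kB mult_left_le_one_le)
    finally have A: "padic_norm ((f (of_nat (y + j * k)) - f (of_nat y)) * q ^ (j * k)) \<le> ?B"
      by (simp add: padic_norm_mult padic_norm_power q1)
    have "padic_norm ((q ^ k) ^ j - (-1) ^ j) \<le> padic_norm (q ^ k + 1)"
      using padic_norm_power_diff_le[of "q ^ k" "-1" j] by (simp add: padic_norm_power q1)
    moreover have "padic_norm (f (of_nat y)) \<le> 1"
      using f by (simp add: padic_unit_lipschitz_def)
    ultimately have "padic_norm (f (of_nat y)) * padic_norm ((q ^ k) ^ j - (-1) ^ j) \<le> padic_norm (q ^ k + 1)"
      by (meson mult_left_le_one_le order.trans padic_norm_nonneg)
    then have B: "padic_norm (f (of_nat y) * (q ^ (j * k) - (-1) ^ j)) \<le> ?B"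
      by (simp add: padic_norm_mult k_def[symmetric] mult.commute[of j] power_mult)
    \<comment> \<open>The error in block j splits into the variation of f over a shift by j k, small
      as |k| = p^(-N), and the replacement of q^(j k) by (-1)^j; the common factor q^y has norm
      1.\<close>
    have "padic_norm (q ^ y * ((f (of_nat (y + j * k)) - f (of_nat y)) * q ^ (j * k) +
        f (of_nat y) * (q ^ (j * k) - (-1) ^ j))) \<le> ?B"
      using padic_norm_add_le[OF A B] by (simp add: padic_norm_mult padic_norm_power q1)
    then show ?thesis by (simp add: algebra_simps power_add)
  qed
  then show ?thesis
    unfolding 1 2 sum_subtractf[symmetric] by (intro padic_norm_sum_le) (auto simp: le_max_iff_disj)
qed

lemma padic_twisted_sum_convergent:
  fixes q :: "'p::prime_card padic"
  assumes p: "odd CARD('p)" and q: "padic_norm (q + 1) < 1" and f: "padic_unit_lipschitz f"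
  shows "convergent (padic_twisted_sum q f)"
proof (rule padic_convergent_of_step)
  have "CARD('p) > 1" using prime_card[where 'a = 'p] by (rule prime_gt_1_nat)
  then have lim: "(\<lambda>N. (1 / real CARD('p)) ^ N) \<longlonglongrightarrow> 0" by (intro LIMSEQ_power_zero) auto
  from tendsto_max[OF lim padic_power_CARD_plus_1_tendsto[OF p q]]
  show "(\<lambda>N. max ((1 / real CARD('p)) ^ N) (padic_norm (q ^ (CARD('p) ^ N) + 1))) \<longlonglongrightarrow> 0"
    by simp
qed (rule padic_twisted_sum_step[OF assms])

lemma padic_fermionic_integrable_lipschitz:
  assumes "odd CARD('p::prime_card)" "padic_unit_lipschitz (f :: 'p padic \<Rightarrow> _)"
  shows "padic_fermionic_integrable f"
  using padic_twisted_sum_convergent[of "-1" f] assms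
  by (simp add: padic_fermionic_integrable_def padic_fermionic_integral_seq_eq)

lemma padic_fermionic_integral_LIMSEQ:
  assumes "padic_fermionic_integrable f"
  shows "padic_fermionic_integral_seq f \<longlonglongrightarrow> padic_fermionic_integral f"
  using assms by (simp add: padic_fermionic_integrable_def padic_fermionic_integral_def convergent_LIMSEQ_iff)

lemma
  fixes q :: "'p::prime_card padic"
  assumes p: "odd CARD('p)" and q: "padic_norm (q + 1) < 1" and f: "padic_unit_lipschitz f"
  shows padic_q_integrable_lipschitz: "padic_q_integrable q f"
    and padic_q_integral_near: "padic_norm (padic_q_integral q f - padic_fermionic_integral f) \<le> padic_norm (q + 1)"
proof -
  let ?w = "\<lambda>N. (1 - q) / (1 - q ^ (CARD('p) ^ N))"
  have q1: "padic_norm q = 1" by (rule padic_norm_eq_1_of_near_minus_1[OF q])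
  have two: "padic_norm (2 :: 'p padic) = 1" by (rule padic_norm_2[OF p])
  have n1: "padic_norm (1 - q) = 1" by (rule padic_norm_one_minus[OF p q])
  note le = padic_norm_power_CARD_plus_1[OF p q]
  have nN: "padic_norm (1 - q ^ (CARD('p) ^ N)) = 1" for N
    by (rule padic_norm_one_minus[OF p]) (use le[of N] q in simp)
  have nz: "1 - q ^ (CARD('p) ^ N) \<noteq> 0" for N
    using nN[of N] by (metis padic_norm_0 zero_neq_one)
  \<comment> \<open>Since q^(p^N) tends to -1, the inverse bracket tends to (1 - q)/2, so the
    normalised sequence inherits convergence from the twisted sums.\<close>
  have w: "?w \<longlonglongrightarrow> (1 - q) / 2"
  proof (rule padic_LIMSEQ_I[OF _ padic_power_CARD_plus_1_tendsto[OF p q]])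
    fix N
    have "?w N - (1 - q) / 2 = (1 - q) * (q ^ (CARD('p) ^ N) + 1) / (2 * (1 - q ^ (CARD('p) ^ N)))"
      using nz[of N] by (simp add: field_simps)
    then show "padic_norm (?w N - (1 - q) / 2) \<le> padic_norm (q ^ (CARD('p) ^ N) + 1)"
      by (simp only: padic_norm_divide padic_norm_mult n1 nN two)
  qed
  obtain L where "padic_twisted_sum q f \<longlonglongrightarrow> L"
    using padic_twisted_sum_convergent[OF p q f] by (auto simp: convergent_def)
  from tendsto_mult[OF w this] have "convergent (padic_q_integral_seq q f)"
    by (auto simp: convergent_def padic_q_integral_seq_eq[abs_def])
  then show "padic_q_integrable q f" by (simp add: padic_q_integrable_def)
  then have lim: "padic_q_integral_seq q f \<longlonglongrightarrow> padic_q_integral q f"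
    by (simp add: padic_q_integrable_def padic_q_integral_def convergent_LIMSEQ_iff)
  have fb: "padic_norm (f (of_nat x)) \<le> 1" for x using f by (simp add: padic_unit_lipschitz_def)
  have "padic_norm (padic_q_integral_seq q f N - padic_fermionic_integral_seq f N) \<le> padic_norm (q + 1)" for N
  proof -
    \<comment> \<open>Two errors are added, each at most |q + 1| uniformly in N: the inverse bracket
      in place of 1, then q^x in place of (-1)^x.\<close>
    have "?w N - 1 = ((q ^ (CARD('p) ^ N) + 1) - (q + 1)) / (1 - q ^ (CARD('p) ^ N))"
      using nz[of N] by (simp add: field_simps)
    then have "padic_norm (?w N - 1) \<le> padic_norm (q + 1)"
      using padic_norm_diff_le[OF le[of N] order.refl] by (simp only: padic_norm_divide nN div_by_1)
    moreover have "padic_norm (padic_twisted_sum q f N) \<le> 1"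
      unfolding padic_twisted_sum_def using fb
      by (intro padic_norm_sum_le) (simp_all add: padic_norm_mult padic_norm_power q1)
    ultimately have A: "padic_norm ((?w N - 1) * padic_twisted_sum q f N) \<le> padic_norm (q + 1)"
      unfolding padic_norm_mult by (meson mult_right_le_one_le order.trans padic_norm_nonneg)
    have "padic_norm (f (of_nat x) * (q ^ x - (-1) ^ x)) \<le> padic_norm (q + 1)" for x
      unfolding padic_norm_mult using padic_norm_power_diff_le[of q "-1" x] q1 fb[of x]
      by (simp, meson mult_left_le_one_le order.trans padic_norm_nonneg)
    then have "padic_norm (\<Sum>x<CARD('p) ^ N. f (of_nat x) * (q ^ x - (-1) ^ x)) \<le> padic_norm (q + 1)"
      by (intro padic_norm_sum_le) simp_all
    then have B: "padic_norm (padic_twisted_sum q f N - padic_twisted_sum (-1) f N) \<le> padic_norm (q + 1)"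
      by (simp add: padic_twisted_sum_def right_diff_distrib sum_subtractf)
    show ?thesis
      using padic_norm_add_le[OF A B]
      by (simp add: padic_q_integral_seq_eq padic_fermionic_integral_seq_eq left_diff_distrib)
  qed
  then show "padic_norm (padic_q_integral q f - padic_fermionic_integral f) \<le> padic_norm (q + 1)"
    using padic_fermionic_integral_LIMSEQ[OF padic_fermionic_integrable_lipschitz[OF p f]]
    by (intro padic_norm_LIMSEQ_le[OF tendsto_diff[OF lim]])
qed

lemma eventually_padic_near_minus_1: "\<forall>\<^sub>F q in at (-1 :: 'p::prime_card padic). padic_norm (q + 1) < 1"
  unfolding eventually_at by (intro exI[of _ 1]) (simp add: dist_padic_def)

lemma padic_q_integral_tendsto:
  assumes p: "odd CARD('p::prime_card)" and f: "padic_unit_lipschitz (f :: 'p padic \<Rightarrow> _)"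
  shows "((\<lambda>q. padic_q_integral q f) \<longlongrightarrow> padic_fermionic_integral f) (at (-1))"
proof (rule iffD2[OF tendsto_dist_iff], rule tendsto_sandwich[OF _ _ tendsto_const])
  show "\<forall>\<^sub>F q in at (-1). dist (padic_q_integral q f) (padic_fermionic_integral f) \<le> dist q (-1)"
    using eventually_padic_near_minus_1
    by eventually_elim (use padic_q_integral_near[OF p _ f] in \<open>simp add: dist_padic_def\<close>)
  show "((\<lambda>q. dist q (-1 :: 'p padic)) \<longlongrightarrow> 0) (at (-1))"
    by (rule iffD1[OF tendsto_dist_iff tendsto_ident_at])
qed simp

subsection \<open>Fermionic integrals of powers, sines and cosines\<close>

lemma padic_fermionic_integral_sum:
  assumes "\<And>k. k \<in> A \<Longrightarrow> padic_fermionic_integrable (f k)"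
  shows "padic_fermionic_integral_seq (\<lambda>x. \<Sum>k\<in>A. c k * f k x)
    \<longlonglongrightarrow> (\<Sum>k\<in>A. c k * padic_fermionic_integral (f k))"
proof -
  have eq: "padic_fermionic_integral_seq (\<lambda>x. \<Sum>k\<in>A. c k * f k x) N =
      (\<Sum>k\<in>A. c k * padic_fermionic_integral_seq (f k) N)" for N
    unfolding padic_fermionic_integral_seq_def sum_distrib_left sum_distrib_right
    by (subst sum.swap) (simp add: mult.assoc)
  show ?thesis
    unfolding eq[abs_def]
    by (intro tendsto_sum tendsto_mult tendsto_const padic_fermionic_integral_LIMSEQ assms)
qed

lemma padic_fermionic_integral_near:
  assumes "padic_fermionic_integral_seq f \<longlonglongrightarrow> I" "padic_fermionic_integral_seq g \<longlonglongrightarrow> J"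
    and "B \<ge> 0" "\<And>n. padic_norm (f (of_nat n) - g (of_nat n)) \<le> B"
  shows "padic_norm (I - J) \<le> B"
proof (rule padic_norm_LIMSEQ_le[OF tendsto_diff[OF assms(1,2)]])
  fix N
  have "padic_norm (\<Sum>x<CARD('a) ^ N. (f (of_nat x) - g (of_nat x)) * (-1) ^ x) \<le> B"
    using assms(3,4) by (intro padic_norm_sum_le) (simp_all add: padic_norm_mult padic_norm_power)
  then show "padic_norm (padic_fermionic_integral_seq f N - padic_fermionic_integral_seq g N) \<le> B"
    by (simp add: padic_fermionic_integral_seq_def left_diff_distrib sum_subtractf)
qed

text \<open>Shifting the index flips every sign and leaves the boundary values at 0 and p^N. Since
  p^N is odd, the second enters with a plus sign, and it tends to f(0) because p^N tends to 0; hence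
  2 f(0).\<close>

lemma padic_fermionic_integral_shift:
  assumes p: "odd CARD('p::prime_card)" and f: "padic_unit_lipschitz (f :: 'p padic \<Rightarrow> _)"
  shows "padic_fermionic_integral_seq (\<lambda>x. f (x + 1)) \<longlonglongrightarrow> 2 * f 0 - padic_fermionic_integral f"
proof -
  have "(\<Sum>x<n. f (of_nat x + 1) * (-1) ^ x) = f 0 - (-1) ^ n * f (of_nat n) - (\<Sum>x<n. f (of_nat x) * (-1) ^ x)"
    for n
    by (induction n) (simp_all add: algebra_simps)
  then have eq: "padic_fermionic_integral_seq (\<lambda>x. f (x + 1)) N =
      f 0 + f (of_nat (CARD('p) ^ N)) - padic_fermionic_integral_seq f N" for N
    using p by (simp add: padic_fermionic_integral_seq_def)
  have "(\<lambda>N. f (of_nat (CARD('p) ^ N))) \<longlonglongrightarrow> f 0"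
  proof (rule padic_LIMSEQ_I)
    show "padic_norm (f (of_nat (CARD('p) ^ N)) - f 0) \<le> (1 / real CARD('p)) ^ N" for N
    proof -
      have "padic_norm (f (of_nat (CARD('p) ^ N)) - f (of_nat 0))
          \<le> padic_norm (of_nat (CARD('p) ^ N) - of_nat 0 :: 'p padic)"
        using f unfolding padic_unit_lipschitz_def by blast
      then show ?thesis by (simp add: padic_norm_power padic_norm_CARD)
    qed
    have "CARD('p) > 1" using prime_card[where 'a = 'p] by (rule prime_gt_1_nat)
    then show "(\<lambda>N. (1 / real CARD('p)) ^ N) \<longlonglongrightarrow> 0" by (intro LIMSEQ_power_zero) auto
  qed
  then have "(\<lambda>N. f 0 + f (of_nat (CARD('p) ^ N)) - padic_fermionic_integral_seq f N)
      \<longlonglongrightarrow> f 0 + f 0 - padic_fermionic_integral f"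
    by (intro tendsto_diff tendsto_add tendsto_const padic_fermionic_integral_LIMSEQ
        padic_fermionic_integrable_lipschitz[OF p f])
  then show ?thesis by (simp add: eq[abs_def])
qed

lemma padic_unit_lipschitz_series:
  fixes f :: "'p::prime_card padic \<Rightarrow> 'p padic"
  assumes f: "\<And>x. (\<lambda>n. c n * of_nat x ^ n) sums f (of_nat x)" and c: "\<And>n. padic_norm (c n) \<le> 1"
  shows "padic_unit_lipschitz f"
  unfolding padic_unit_lipschitz_def
proof (intro conjI allI)
  fix x y :: nat
  have le: "padic_norm (of_nat k :: 'p padic) \<le> 1" for k by (rule padic_norm_of_nat_le_1)
  have "padic_norm (c n * of_nat x ^ n) \<le> 1" for n
    using c le by (simp add: padic_norm_mult padic_norm_power mult_le_one power_le_one)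
  from padic_sums_tail_le[OF f[of x], of 0 1, OF this] show "padic_norm (f (of_nat x)) \<le> 1" by simp
  have "(\<lambda>n. c n * (of_nat x ^ n - of_nat y ^ n)) sums (f (of_nat x) - f (of_nat y))"
    using tendsto_diff[OF f[of x, unfolded sums_def] f[of y, unfolded sums_def]]
    by (simp add: sums_def right_diff_distrib sum_subtractf)
  moreover have "padic_norm (c n * (of_nat x ^ n - of_nat y ^ n)) \<le> padic_norm (of_nat x - of_nat y :: 'p padic)" for n
    unfolding padic_norm_mult using c[of n] padic_norm_power_diff_le[OF le[of x] le[of y], of n]
    by (meson mult_left_le_one_le order.trans padic_norm_nonneg)
  ultimately show "padic_norm (f (of_nat x) - f (of_nat y)) \<le> padic_norm (of_nat x - of_nat y :: 'p padic)"
    using padic_sums_tail_le[of _ "f (of_nat x) - f (of_nat y)" 0] by fastforce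
qed

lemma padic_unit_lipschitz_power: "padic_unit_lipschitz (\<lambda>x :: 'p::prime_card padic. x ^ n)"
  using padic_norm_of_nat_le_1[where 'p = 'p]
  by (auto simp: padic_unit_lipschitz_def padic_norm_power power_le_one intro: padic_norm_power_diff_le)

text \<open>Truncation at K costs at most r^K uniformly at all naturals, and summing against weights
  of norm 1 does not enlarge this. The integrals of the truncations therefore converge to that of
  f.\<close>

lemma padic_fermionic_integral_series:
  fixes f :: "'p::prime_card padic \<Rightarrow> 'p padic"
  assumes p: "odd CARD('p)" and f: "\<And>x. (\<lambda>n. c n * of_nat x ^ n) sums f (of_nat x)"
    and c: "\<And>n. padic_norm (c n) \<le> r ^ n" and r: "0 \<le> r" "r < 1"
  shows "(\<lambda>n. c n * padic_fermionic_integral (\<lambda>x. x ^ n)) sums padic_fermionic_integral f"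
proof -
  have cK: "padic_norm (c n) \<le> r ^ K" if "n \<ge> K" for n K
    using c[of n] power_decreasing[OF that r(1)] r(2) by simp
  have lip: "padic_unit_lipschitz f"
    using cK[of 0] by (intro padic_unit_lipschitz_series[OF f]) simp
  have le: "padic_norm (padic_fermionic_integral f -
      (\<Sum>n<K. c n * padic_fermionic_integral (\<lambda>x. x ^ n))) \<le> r ^ K" for K
  proof (rule padic_fermionic_integral_near)
    show "padic_fermionic_integral_seq f \<longlonglongrightarrow> padic_fermionic_integral f"
      by (intro padic_fermionic_integral_LIMSEQ padic_fermionic_integrable_lipschitz[OF p lip])
    show "padic_fermionic_integral_seq (\<lambda>x. \<Sum>n<K. c n * x ^ n)
        \<longlonglongrightarrow> (\<Sum>n<K. c n * padic_fermionic_integral (\<lambda>x. x ^ n))"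
      by (intro padic_fermionic_integral_sum padic_fermionic_integrable_lipschitz[OF p]
          padic_unit_lipschitz_power)
    fix x
    have "padic_norm (c n * of_nat x ^ n) \<le> r ^ K" if "n \<ge> K" for n
      using cK[OF that] padic_norm_of_nat_le_1[of x, where 'p = 'p]
      unfolding padic_norm_mult padic_norm_power
      by (meson mult_right_le_one_le order.trans padic_norm_nonneg power_le_one zero_le_power)
    then show "padic_norm (f (of_nat x) - (\<Sum>n<K. c n * of_nat x ^ n)) \<le> r ^ K"
      using r(1) by (intro padic_sums_tail_le[OF f]) auto
  qed (use r in simp)
  show ?thesis unfolding sums_def
  proof (rule padic_LIMSEQ_I)
    show "padic_norm ((\<Sum>n<K. c n * padic_fermionic_integral (\<lambda>x. x ^ n)) -
        padic_fermionic_integral f) \<le> r ^ K" for K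
      using le[of K] by (subst padic_norm_minus_commute)
    show "(\<lambda>K. r ^ K) \<longlonglongrightarrow> 0" using r by (intro LIMSEQ_power_zero) simp
  qed
qed

text \<open>The coefficient of T^n in E(T) (e^T + 1) = 2, multiplied by n!.\<close>

lemma euler_number_rec:
  "(\<Sum>k\<le>n. of_nat (n choose k) * euler_number k) + euler_number n = (if n = 0 then 2 else 0)"
proof -
  define E :: "rat fps" where "E = 2 / (fps_exp 1 + 1)"
  \<comment> \<open>The constant coefficient is 2, so the division defining \<open>E\<close> is
    exact.\<close>
  have "is_unit (fps_exp 1 + 1 :: rat fps)" by (simp add: fps_is_unit_iff)
  then have "E * (fps_exp 1 + 1) = 2"
    unfolding E_def by (rule dvd_div_mult_self[OF unit_imp_dvd])
  then have "fps_nth (E * fps_exp 1 + E) n = fps_nth 2 n" by (simp add: distrib_left)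
  then have "(\<Sum>k=0..n. fps_nth E k * (1 / fact (n - k))) + fps_nth E n = (if n = 0 then 2 else 0)"
    by (simp add: fps_mult_nth numeral_fps_const)
  then have "fact n * ((\<Sum>k=0..n. fps_nth E k * (1 / fact (n - k))) + fps_nth E n) = (if n = 0 then 2 else 0)"
    by auto
  moreover have "fact n * (fps_nth E k * (1 / fact (n - k))) = of_nat (n choose k) * euler_number k"
    if "k \<le> n" for k
    using that by (simp add: euler_number_def E_def binomial_fact field_simps)
  ultimately show ?thesis
    by (simp add: distrib_left sum_distrib_left atLeast0AtMost euler_number_def[of n] E_def[symmetric])
qed

text \<open>Expanding (x + 1)^n in the shift relation gives the Euler recurrence. The k = n term
  joins the other copy of the n-th integral to give coefficient 2, so the earlier integrals
  determine it. The convention 0^0 = 1 covers n = 0.\<close>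

lemma padic_fermionic_integral_power:
  assumes p: "odd CARD('p::prime_card)"
  shows "padic_fermionic_integral (\<lambda>x :: 'p padic. x ^ n) = of_rat (euler_number n)"
proof (induction n rule: less_induct)
  case (less n)
  let ?I = "\<lambda>k. padic_fermionic_integral (\<lambda>x :: 'p padic. x ^ k)"
  have "padic_fermionic_integral_seq (\<lambda>x :: 'p padic. (x + 1) ^ n) \<longlonglongrightarrow> 2 * 0 ^ n - ?I n"
    by (rule padic_fermionic_integral_shift[OF p padic_unit_lipschitz_power])
  moreover have "padic_fermionic_integral_seq (\<lambda>x :: 'p padic. (x + 1) ^ n)
      \<longlonglongrightarrow> (\<Sum>k\<le>n. of_nat (n choose k) * ?I k)"
    unfolding binomial_ring[of _ 1] power_one mult_1_right
    by (intro padic_fermionic_integral_sum padic_fermionic_integrable_lipschitz[OF p]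
        padic_unit_lipschitz_power)
  ultimately have "(\<Sum>k\<le>n. of_nat (n choose k) * ?I k) = 2 * 0 ^ n - ?I n"
    by (rule LIMSEQ_unique[rotated])
  then have I: "(\<Sum>k<n. of_nat (n choose k) * ?I k) + 2 * ?I n = 2 * 0 ^ n"
    by (simp add: algebra_simps flip: lessThan_Suc_atMost)
  have "(\<Sum>k<n. of_nat (n choose k) * euler_number k) + 2 * euler_number n = 2 * 0 ^ n"
    using euler_number_rec[of n] by (auto simp: power_0_left simp flip: lessThan_Suc_atMost)
  then have "of_rat ((\<Sum>k<n. of_nat (n choose k) * euler_number k) + 2 * euler_number n) =
      (of_rat (2 * 0 ^ n) :: 'p padic)" by simp
  then have "(\<Sum>k<n. of_nat (n choose k) * of_rat (euler_number k)) + 2 * of_rat (euler_number n) =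
      (2 * 0 ^ n :: 'p padic)"
    by (simp add: of_rat_add of_rat_mult of_rat_sum of_rat_power)
  also have "\<dots> = (\<Sum>k<n. of_nat (n choose k) * of_rat (euler_number k)) + 2 * ?I n"
    using I less.IH by simp
  finally show ?case by simp
qed

lemma
  fixes a :: "'p::prime_card padic"
  assumes p: "odd CARD('p)" and a: "padic_norm a < 1"
  shows padic_unit_lipschitz_sin: "padic_unit_lipschitz (\<lambda>x. padic_sin (a * x))"
    and padic_unit_lipschitz_cos: "padic_unit_lipschitz (\<lambda>x. padic_cos (a * x))"
    and padic_fermionic_integral_sin:
      "padic_fermionic_integral (\<lambda>x. padic_sin (a * x)) = - padic_tan (a / 2)"
    and padic_fermionic_integral_sin_sums:
      "(\<lambda>n. (-1) ^ n * a ^ (2 * n + 1) / fact (2 * n + 1) * of_rat (euler_number (2 * n + 1)))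
        sums padic_fermionic_integral (\<lambda>x. padic_sin (a * x))"
proof -
  obtain r where r: "0 \<le> r" "r < 1" "\<And>n. padic_norm (a ^ n / fact n) \<le> r ^ n"
    using padic_exp_coeff_le[OF p] a by metis
  have r1: "r ^ n \<le> 1" for n using r by (simp add: power_le_one)
  have ax: "padic_norm (a * of_nat x) < 1" for x
    using mult_left_le[OF padic_norm_of_nat_le_1[of x] padic_norm_nonneg[of a]] a
    unfolding padic_norm_mult by (rule le_less_trans)
  have S: "(\<lambda>n. fps_nth (fps_sin a) n * of_nat x ^ n) sums padic_sin (a * of_nat x)"
    and C: "(\<lambda>n. fps_nth (fps_cos a) n * of_nat x ^ n) sums padic_cos (a * of_nat x)" for x
    using padic_sin_sums[OF p ax] padic_cos_sums[OF p ax]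
    by (simp_all add: fps_sin_nth_power[abs_def] fps_cos_nth_power[abs_def])
  have Sr: "padic_norm (fps_nth (fps_sin a) n) \<le> r ^ n" and Cr: "padic_norm (fps_nth (fps_cos a) n) \<le> r ^ n" for n
    using padic_norm_fps_sin_le padic_norm_fps_cos_le r(3) by (blast intro: order.trans)+
  show lipS: "padic_unit_lipschitz (\<lambda>x. padic_sin (a * x))"
    by (rule padic_unit_lipschitz_series[OF S]) (rule order.trans[OF Sr r1])
  show lipC: "padic_unit_lipschitz (\<lambda>x. padic_cos (a * x))"
    by (rule padic_unit_lipschitz_series[OF C]) (rule order.trans[OF Cr r1])
  let ?S = "padic_fermionic_integral (\<lambda>x. padic_sin (a * x))"
    and ?C = "padic_fermionic_integral (\<lambda>x. padic_cos (a * x))"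
  have "(\<lambda>n. fps_nth (fps_sin a) n * of_rat (euler_number n)) sums ?S"
    using padic_fermionic_integral_series[OF p S Sr r(1,2)]
    by (simp add: padic_fermionic_integral_power[OF p])
  then have "(\<lambda>n. fps_nth (fps_sin a) (2 * n + 1) * of_rat (euler_number (2 * n + 1))) sums ?S"
    by (rule sums_odd_part) (simp add: fps_sin_def)
  then show "(\<lambda>n. (-1) ^ n * a ^ (2 * n + 1) / fact (2 * n + 1) * of_rat (euler_number (2 * n + 1)))
      sums ?S"
    by (simp add: fps_sin_def del: fact_Suc)
  note lim = padic_fermionic_integral_LIMSEQ[OF padic_fermionic_integrable_lipschitz[OF p lipS]]
    padic_fermionic_integral_LIMSEQ[OF padic_fermionic_integrable_lipschitz[OF p lipC]]
  have sin_Suc: "padic_sin (a * (of_nat x + 1)) = padic_sin (a * of_nat x) * padic_cos a + padic_cos (a * of_nat x) * padic_sin a" for x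
    using padic_sin_add[OF p ax a] by (simp add: distrib_left)
  have add: "padic_fermionic_integral_seq (\<lambda>x. padic_sin (a * (x + 1))) N =
      padic_cos a * padic_fermionic_integral_seq (\<lambda>x. padic_sin (a * x)) N +
      padic_sin a * padic_fermionic_integral_seq (\<lambda>x. padic_cos (a * x)) N" for N
    unfolding padic_fermionic_integral_seq_def sin_Suc
    by (simp add: sum_distrib_left algebra_simps flip: sum.distrib)
  have "padic_fermionic_integral_seq (\<lambda>x. padic_sin (a * (x + 1)))
      \<longlonglongrightarrow> padic_cos a * ?S + padic_sin a * ?C"
    unfolding add[abs_def] by (intro tendsto_add tendsto_mult tendsto_const lim)
  \<comment> \<open>The boundary term 2 sin 0 vanishes, so this equation is homogeneous; 2 cos 0 = 2
    supplies the constant of the other one.\<close>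
  from LIMSEQ_unique[OF this padic_fermionic_integral_shift[OF p lipS]]
  have 1: "padic_cos a * ?S + padic_sin a * ?C = - ?S" by simp
  have cos_Suc: "padic_cos (a * (of_nat x + 1)) = padic_cos (a * of_nat x) * padic_cos a - padic_sin (a * of_nat x) * padic_sin a" for x
    using padic_cos_add[OF p ax a] by (simp add: distrib_left)
  have diff: "padic_fermionic_integral_seq (\<lambda>x. padic_cos (a * (x + 1))) N =
      padic_cos a * padic_fermionic_integral_seq (\<lambda>x. padic_cos (a * x)) N -
      padic_sin a * padic_fermionic_integral_seq (\<lambda>x. padic_sin (a * x)) N" for N
    unfolding padic_fermionic_integral_seq_def cos_Suc
    by (simp add: sum_distrib_left algebra_simps flip: sum_subtractf)
  have "padic_fermionic_integral_seq (\<lambda>x. padic_cos (a * (x + 1)))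
      \<longlonglongrightarrow> padic_cos a * ?C - padic_sin a * ?S"
    unfolding diff[abs_def] by (intro tendsto_diff tendsto_mult tendsto_const lim)
  from LIMSEQ_unique[OF this padic_fermionic_integral_shift[OF p lipC]]
  have 2: "padic_cos a * ?C - padic_sin a * ?S = 2 - ?C" by simp
  \<comment> \<open>Half-angle form: 1 + cos a = 2 c^2 and sin a = 2 s c expose the nonzero factor 2
    c in the first equation. It yields S c = - s C, and the second then reduces to (c^2 + s^2) C =
    1.\<close>
  define s c where "s = padic_sin (a / 2)" and "c = padic_cos (a / 2)"
  have h: "padic_norm (a / 2) < 1" using a by (simp add: padic_norm_divide padic_norm_2[OF p])
  have c0: "c \<noteq> 0" unfolding c_def by (rule padic_cos_nonzero[OF p h])
  have sq: "s * s = 1 - c * c" using padic_sin_cos_squared[OF p h h] by (simp add: s_def c_def eq_diff_eq add.commute)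
  have sa: "padic_sin a = 2 * (s * c)" and ca: "padic_cos a = c * c - s * s"
    using padic_sin_add[OF p h h] padic_cos_add[OF p h h] by (simp_all add: s_def c_def)
  have "2 * c * (?S * c + s * ?C) = 0"
    using 1 unfolding sa ca sq by (simp add: algebra_simps)
  then have Sc: "?S * c = - (s * ?C)" using c0 by (simp add: eq_neg_iff_add_eq_0)
  have "2 * (c * c * ?C - s * (?S * c)) = 2"
    using 2 unfolding sa ca sq by (simp add: algebra_simps)
  then have "2 * (c * c * ?C - s * (?S * c)) = 2 * 1" by (simp only: mult_1_right)
  then have "c * c * ?C - s * (?S * c) = 1"
    using mult_left_cancel[OF zero_neq_numeral[symmetric]] by blast
  then have "c * c * ?C + (s * s) * ?C = 1" unfolding Sc by (simp add: algebra_simps)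
  then have "?C = 1" unfolding sq by (simp add: algebra_simps)
  then show "?S = - padic_tan (a / 2)"
    using Sc c0 by (simp add: padic_tan_def s_def c_def field_simps)
qed

text \<open>Series and integrals are total functions with unspecified values where they diverge, so
  the conclusion also records domains, integrability and summability. Convergence of the sine series
  at a is what the integrand itself demands at x = 1.\<close>

theorem theorem13:
  fixes a :: "'p::prime_card padic"
  assumes "odd CARD('p)"
    and "a \<in> padic_ints"
    and "a \<in> padic_sin_domain"
  shows "(\<forall>x\<in>padic_ints. a * x \<in> padic_sin_domain) \<and>
    a / 2 \<in> padic_tan_domain \<and>
    (\<forall>\<^sub>F q in at (-1). padic_q_integrable q (\<lambda>x. padic_sin (a * x))) \<and>
    padic_fermionic_integrable (\<lambda>x. padic_sin (a * x)) \<and>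
    ((\<lambda>q. padic_q_integral q (\<lambda>x. padic_sin (a * x))) \<longlongrightarrow>
      padic_fermionic_integral (\<lambda>x. padic_sin (a * x))) (at (-1)) \<and>
    padic_tan (a / 2) = - padic_fermionic_integral (\<lambda>x. padic_sin (a * x)) \<and>
    (\<lambda>n. (-1) ^ (n + 1) * a ^ (2 * n + 1) / fact (2 * n + 1) * of_rat (euler_number (2 * n + 1)))
      sums padic_tan (a / 2)"
proof (intro conjI ballI)
  note p = assms(1)
  have a: "padic_norm a < 1" by (rule padic_norm_less_1_of_sin_domain[OF assms(2,3)])
  note lip = padic_unit_lipschitz_sin[OF p a]
  have h: "padic_norm (a / 2) < 1" using a by (simp add: padic_norm_divide padic_norm_2[OF p])
  show "a * x \<in> padic_sin_domain" if "x \<in> padic_ints" for x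
    using that a mult_left_le[of "padic_norm x" "padic_norm a"]
    by (intro padic_sin_domainI[OF p]) (simp add: padic_ints_def padic_norm_mult)
  show "a / 2 \<in> padic_tan_domain"
    using padic_sin_domainI[OF p h] padic_cos_domainI[OF p h] padic_cos_nonzero[OF p h]
    by (simp add: padic_tan_domain_def)
  show "\<forall>\<^sub>F q in at (-1). padic_q_integrable q (\<lambda>x. padic_sin (a * x))"
    using eventually_padic_near_minus_1
    by (rule eventually_mono) (rule padic_q_integrable_lipschitz[OF p _ lip])
  show "padic_fermionic_integrable (\<lambda>x. padic_sin (a * x))"
    by (rule padic_fermionic_integrable_lipschitz[OF p lip])
  show "((\<lambda>q. padic_q_integral q (\<lambda>x. padic_sin (a * x))) \<longlongrightarrow>
      padic_fermionic_integral (\<lambda>x. padic_sin (a * x))) (at (-1))"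
    by (rule padic_q_integral_tendsto[OF p lip])
  show tan: "padic_tan (a / 2) = - padic_fermionic_integral (\<lambda>x. padic_sin (a * x))"
    by (simp add: padic_fermionic_integral_sin[OF p a])
  show "(\<lambda>n. (-1) ^ (n + 1) * a ^ (2 * n + 1) / fact (2 * n + 1) * of_rat (euler_number (2 * n + 1)))
      sums padic_tan (a / 2)"
    using tendsto_minus[OF padic_fermionic_integral_sin_sums[OF p a, unfolded sums_def]]
    by (simp add: sums_def tan sum_negf[symmetric] del: fact_Suc)
qed

end
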